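(* The following continued fraction converges and \[ \left(\frac{\Gamma(1/4)}{\Gamma(3/4)}\right)^4 =80-\cfrac{160}{47+\cfrac{3^4}{44\cdot2^2+1+\cfrac{5^4}{44\cdot3^2+1+\cfrac{7^4}{44\cdot4^2+1+\cdots}}}}, \] that is, the value is $a(0)+\cfrac{b(0)}{a(1)+\cfrac{b(1)}{a(2)+\cdots}}$ with $a(0)=80$, $a(1)=47$, $a(n)=44n^2+1$ for $n\ge2$, $b(0)=-160$, and $b(n)=(2n+1)^4$ for $n\ge1$. Moreover, if $p(n)/q(n)$ denotes the $n$-th convergent, then as $n\to\infty$ \[ \left(\frac{\Gamma(1/4)}{\Gamma(3/4)}\right)^4-\frac{p(n)}{q(n)}\sim(-1)^{n+1}\frac{8\,(\Gamma(1/4)/\Gamma(3/4))^4}{\big((1+\sqrt5)/2\big)^{10n+10}}. \]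
   Context: For sequences $a(n),b(n)$, the $n$-th convergent $p(n)/q(n)$ of the continued fraction $a(0)+\cfrac{b(0)}{a(1)+\cfrac{b(1)}{a(2)+\cdots}}$ is the finite truncation $a(0)+\cfrac{b(0)}{a(1)+\cfrac{b(1)}{\ddots+\cfrac{b(n-1)}{a(n)}}}$. *)

theory Defs
  imports "HOL-Analysis.Analysis" "HOL-Library.Landau_Symbols"
begin

fun cf_tail :: "(nat \<Rightarrow> real) \<Rightarrow> (nat \<Rightarrow> real) \<Rightarrow> nat \<Rightarrow> nat \<Rightarrow> real" where
  "cf_tail a b m 0 = a m"
| "cf_tail a b m (Suc n) = a m + b m / cf_tail a b (Suc m) n"

definition cf_convergent :: "(nat \<Rightarrow> real) \<Rightarrow> (nat \<Rightarrow> real) \<Rightarrow> nat \<Rightarrow> real" where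
  "cf_convergent a b n = cf_tail a b 0 n"

definition cfA :: "nat \<Rightarrow> real" where
  "cfA n = (if n = 0 then 80 else if n = 1 then 47 else 44 * (real n)^2 + 1)"

definition cfB :: "nat \<Rightarrow> real" where
  "cfB n = (if n = 0 then -160 else (2 * real n + 1)^4)"

end

theory Submission
  imports Defs "HOL-Probability.Distributions" "HOL-Real_Asymp.Real_Asymp"
begin

text \<open>
  After division by \<open>((2n-1)!!)\<^sup>2\<close> the recurrence of the convergents becomes Apery's recurrence for
  \<open>\<zeta>(2)\<close>, taken at half-integers. With alternating signs, it is solved by the integrals
  \<open>apery_F \<nu> = \<integral>\<integral> (x(1-x)y(1-y))\<^sup>\<nu> (1-xy)\<^bsup>-\<nu>-1\<^esup> dx dy\<close>. Expanded into a hypergeometric series, they satisfy the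
  recurrence by creative telescoping; the initial values \<open>apery_F (-1/2)\<close> and \<open>apery_F (1/2)\<close> reduce
  to two instances of Watson's theorem. These initial values identify \<open>apery_F (n+1/2)\<close> with the remainder
  \<open>p(n) - V q(n)\<close>, where \<open>V\<close> is the value of the fraction. Laplace's method gives the asymptotics of the
  integral with its exact constant, and the Casoratian transfers it to \<open>q(n)\<close>.
\<close>

section \<open>Hypergeometric sums and telescoping\<close>

text \<open>The integrals form the decaying solution of the recurrence, as a remainder must, so
  \<open>V\<close> is forced by the quotient of two initial values:
  \<open>apery_F (1/2) / apery_F (-1/2) = 40 / V - 1/2\<close>. The obstacle is
  \<open>apery_F (1/2)\<close>, which is not itself a Watson sum; a contiguous relation reduces it
  to one. The case of Watson's theorem with three equal numerator parameters is enough, and it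
  follows from a first-order recurrence and monotonicity instead of 3F2 transformations. Up to
  squared double factorials, remainders decay like \<open>phi ^ (- 5 n)\<close> and denominators
  grow like \<open>phi ^ (5 n)\<close>; their quotient gives the exponent \<open>10 n\<close>. No
  second solution of the recurrence is analysed: besides the Casoratian, only the limit of the ratio
  of consecutive denominators is required.\<close>

lemma Gamma_fact_ratio_limit:
  fixes z :: real
  assumes "z > 0"
  shows "(\<lambda>k. Gamma (real k + z) / fact k / real k powr (z - 1)) \<longlonglongrightarrow> 1"
proof -
  have z: "z \<notin> \<int>\<^sub>\<le>\<^sub>0" using assms by auto
  have G: "Gamma z \<noteq> 0" using assms by (metis Gamma_real_pos less_irrefl)
  have "(\<lambda>k. Gamma z / Gamma_series' z k) \<longlonglongrightarrow> Gamma z / Gamma z"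
    by (intro tendsto_intros Gamma_series'_LIMSEQ G)
  moreover have "eventually (\<lambda>k. Gamma z / Gamma_series' z k =
      Gamma (real k + z) / fact k / real k powr (z - 1)) sequentially"
    using eventually_gt_at_top[of 0]
  proof eventually_elim
    case (elim k)
    have "pochhammer z k = Gamma (real k + z) / Gamma z"
      using pochhammer_Gamma[OF z, of k] by (simp add: add_ac)
    moreover have "fact k = real k * fact (k - 1)" using elim by (simp add: fact_reduce)
    ultimately show ?case
      using elim G by (simp add: Gamma_series'_def powr_def left_diff_distrib exp_diff field_simps)
  qed
  ultimately show ?thesis using G by (auto intro: Lim_transform_eventually)
qed

text \<open>Up to a factor independent of \<open>k\<close>, the term of 3F2(a, a, a; d, e; 1). With
  Gamma in place of Pochhammer symbols, a unit shift of a parameter multiplies or divides the term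
  by a polynomial in \<open>k\<close>.\<close>

definition hyp_term :: "real \<Rightarrow> real \<Rightarrow> real \<Rightarrow> nat \<Rightarrow> real" where
  "hyp_term a d e k = Gamma (real k + a) ^ 3 / (fact k * Gamma (real k + d) * Gamma (real k + e))"

lemma hyp_term_pos: "a > 0 \<Longrightarrow> d > 0 \<Longrightarrow> e > 0 \<Longrightarrow> hyp_term a d e k > 0"
  unfolding hyp_term_def by (intro divide_pos_pos mult_pos_pos zero_less_power Gamma_real_pos) auto

text \<open>Each Gamma factor is k! times a power of k, and the factorials cancel. What remains is
  the exponent 3 (a - 1) - (d - 1) - (e - 1), so the series converges once d + e - 3 a > 0.\<close>

lemma hyp_term_asymp:
  assumes "a > 0" "d > 0" "e > 0"
  shows "(\<lambda>k. hyp_term a d e k / real k powr (3 * a - d - e - 1)) \<longlonglongrightarrow> 1"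
proof -
  let ?g = "\<lambda>z k. Gamma (real k + z) / fact k / real k powr (z - 1)"
  have "(\<lambda>k. ?g a k ^ 3 / (?g d k * ?g e k)) \<longlonglongrightarrow> 1 ^ 3 / (1 * 1)"
    by (intro tendsto_intros Gamma_fact_ratio_limit assms) auto
  moreover have "eventually (\<lambda>k. ?g a k ^ 3 / (?g d k * ?g e k) =
      hyp_term a d e k / real k powr (3 * a - d - e - 1)) sequentially"
    using eventually_gt_at_top[of 0]
  proof eventually_elim
    case (elim k)
    have "real k powr (3 * a - d - e - 1) =
        (real k powr (a - 1)) ^ 3 / (real k powr (d - 1) * real k powr (e - 1))"
      using elim by (simp add: powr_realpow[symmetric] powr_powr powr_add[symmetric]
        powr_diff[symmetric] powr_power algebra_simps)
    moreover have "Gamma (real k + d) > 0" "Gamma (real k + e) > 0"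
      using assms by (auto intro!: Gamma_real_pos)
    ultimately show ?case
      using elim by (simp add: hyp_term_def field_simps power3_eq_cube)
  qed
  ultimately show ?thesis by (auto intro: Lim_transform_eventually)
qed

lemma hyp_term_powr_tendsto_0:
  assumes "a > 0" "d > 0" "e > 0" "real j < d + e + 1 - 3 * a"
  shows "(\<lambda>k. real k ^ j * hyp_term a d e k) \<longlonglongrightarrow> 0"
proof -
  let ?s = "real j + (3 * a - d - e - 1)"
  have "(\<lambda>k. real k powr ?s) \<longlonglongrightarrow> 0"
    using assms by (intro tendsto_neg_powr filterlim_real_sequentially) auto
  from tendsto_mult[OF this hyp_term_asymp[OF assms(1-3)]]
  have "(\<lambda>k. real k powr ?s * (hyp_term a d e k / real k powr (3 * a - d - e - 1))) \<longlonglongrightarrow> 0"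
    by simp
  moreover have "eventually (\<lambda>k. real k powr ?s * (hyp_term a d e k / real k powr (3 * a - d - e - 1))
     = real k ^ j * hyp_term a d e k) sequentially"
    using eventually_gt_at_top[of 0]
  proof eventually_elim
    case (elim k)
    have "real k powr ?s = real k ^ j * real k powr (3 * a - d - e - 1)"
      using elim by (subst powr_add) (simp add: powr_realpow)
    thus ?case using elim by simp
  qed
  ultimately show ?thesis by (auto intro: Lim_transform_eventually)
qed

lemma summable_hyp_term:
  assumes "a > 0" "d > 0" "e > 0" "d + e - 3 * a > 0"
  shows "summable (hyp_term a d e)"
proof -
  have ev: "eventually (\<lambda>k. hyp_term a d e k / real k powr (3 * a - d - e - 1) < 2) sequentially"
    using order_tendstoD(2)[OF hyp_term_asymp[OF assms(1-3)], of 2] by simp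
  show ?thesis
  proof (rule summable_comparison_test_ev)
    show "eventually (\<lambda>k. norm (hyp_term a d e k) \<le> 2 * real k powr (3 * a - d - e - 1)) sequentially"
      using ev eventually_gt_at_top[of 0]
    proof eventually_elim
      case (elim k)
      thus ?case using hyp_term_pos[OF assms(1-3), of k] by (simp add: field_simps)
    qed
    show "summable (\<lambda>k. 2 * real k powr (3 * a - d - e - 1))"
      using assms by (intro summable_mult) (simp add: summable_real_powr_iff)
  qed
qed

lemma Gamma_real_plus1: "x > 0 \<Longrightarrow> Gamma (x + 1) = x * Gamma (x :: real)"
  by (rule Gamma_plus1) auto

lemma Gamma_three_halves: "Gamma (3/2 :: real) = sqrt pi / 2"
  using Gamma_real_plus1[of "1/2"] Gamma_one_half_real by simp

lemma hyp_term_raise_num: "a > 0 \<Longrightarrow> hyp_term (a + 1) d e k = (real k + a) ^ 3 * hyp_term a d e k"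
  using Gamma_real_plus1[of "real k + a"]
  by (simp add: hyp_term_def power_mult_distrib add.assoc)

lemma hyp_term_raise_den1:
  assumes "d > 0"
  shows "hyp_term a d e k = (real k + d) * hyp_term a (d + 1) e k"
proof -
  have "Gamma (real k + (d + 1)) = (real k + d) * Gamma (real k + d)"
    using Gamma_real_plus1[of "real k + d"] assms by (simp add: add.assoc)
  thus ?thesis using assms by (simp add: hyp_term_def)
qed

lemma hyp_term_raise_den2:
  assumes "e > 0"
  shows "hyp_term a d e k = (real k + e) * hyp_term a d (e + 1) k"
  using hyp_term_raise_den1[OF assms, of a d k] by (simp add: hyp_term_def mult_ac)

text \<open>A shift of the index is a simultaneous shift of all parameters, with a quotient k + 1
  left over from the factorial. This reduces both sides of a telescoping identity to one common
  term.\<close>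

lemma hyp_term_Suc: "hyp_term a d e (Suc k) = hyp_term (a + 1) (d + 1) (e + 1) k / (real k + 1)"
  by (simp add: hyp_term_def add_ac)

lemma telescope_tendsto_0_sums:
  fixes G :: "nat \<Rightarrow> real"
  assumes "\<And>k. x k = G (Suc k) - G k" "G \<longlonglongrightarrow> 0"
  shows "x sums (- G 0)"
  using telescope_sums[OF assms(2)] by (simp add: assms(1)[abs_def])

section \<open>The two families of 3F2 sums and their recurrences\<close>

definition hyp_sum :: "real \<Rightarrow> real \<Rightarrow> real \<Rightarrow> real" where
  "hyp_sum a d e = suminf (hyp_term a d e)"

lemma hyp_sum_sums: "a > 0 \<Longrightarrow> d > 0 \<Longrightarrow> e > 0 \<Longrightarrow> d + e - 3 * a > 0 \<Longrightarrow> hyp_term a d e sums hyp_sum a d e"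
  unfolding hyp_sum_def by (intro summable_sums summable_hyp_term)

definition apery_F :: "real \<Rightarrow> real" where
  "apery_F v = Gamma (v + 1) * hyp_sum (v + 1) (2 * v + 2) (2 * v + 2)"

text \<open>Watson's theorem concerns 3F2(a, b, c; (a + b + 1)/2, 2c; 1); this is the case a = b = c
  = m + 1. The factor \<open>sqrt pi\<close> is Gamma(1/2), which makes the sum equal to an Euler
  integral.\<close>

definition watson_L :: "real \<Rightarrow> real" where
  "watson_L m = sqrt pi * hyp_sum (m + 1) (m + 3 / 2) (2 * m + 2)"

text \<open>Kills the boundary term at infinity in creative telescoping. The top power is
  \<open>k ^ length cs\<close>, to be beaten by the decay k^(3a - d - e - 1).\<close>

lemma horner_sum_hyp_term_tendsto_0:
  assumes "a > 0" "d > 0" "e > 0" "real (length cs) < d + e + 1 - 3 * a"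
  shows "(\<lambda>k. real k * horner_sum id (real k) cs * hyp_term a d e k) \<longlonglongrightarrow> 0"
proof -
  have "(\<lambda>k. \<Sum>i<length cs. cs ! i * (real k ^ Suc i * hyp_term a d e k)) \<longlonglongrightarrow> (\<Sum>i<length cs. cs ! i * 0)"
    using assms by (intro tendsto_sum tendsto_mult tendsto_const hyp_term_powr_tendsto_0) auto
  thus ?thesis
    by (simp add: horner_sum_eq_sum sum_distrib_left sum_distrib_right mult_ac atLeast0LessThan)
qed

lemma apery_F_recurrence:
  assumes v: "v > 0"
  shows "(v + 1)\<^sup>2 * apery_F (v + 1) + (11 * v\<^sup>2 + 11 * v + 3) * apery_F v = v\<^sup>2 * apery_F (v - 1)"
proof -
  \<comment> \<open>Zeilberger certificate; the coefficients come from solving a linear system.\<close>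
  define P where "P = (\<lambda>k. horner_sum id k
    [-32 * v^3 - 163 * v^4 - 309 * v^5 - 257 * v^6 - 79 * v^7,
     -44 * v^2 - 273 * v^3 - 619 * v^4 - 607 * v^5 - 217 * v^6,
     -16 * v - 141 * v^2 - 419 * v^3 - 516 * v^4 - 225 * v^5,
     -19 * v - 100 * v^2 - 176 * v^3 - 102 * v^4,
     -4 * v - 13 * v^2 - 13 * v^3, 3 * v + 4 * v^2, v])"
  \<comment> \<open>The factor \<open>real k\<close> serves twice: it makes \<open>G 0\<close>
    vanish, and in \<open>G (Suc k)\<close> it cancels the quotient \<open>x + 1\<close> from
    \<open>hyp_term_Suc\<close>. Decay at infinity amounts to 7 < v + 7.\<close>
  define G where "G = (\<lambda>k. real k * P (real k) * hyp_term v (2 * v + 3) (2 * v + 3) k)"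
  define A where "A = hyp_term (v + 2) (2 * v + 4) (2 * v + 4)"
  define B where "B = hyp_term (v + 1) (2 * v + 2) (2 * v + 2)"
  define C where "C = hyp_term v (2 * v) (2 * v)"
  have G0: "G \<longlonglongrightarrow> 0"
    unfolding G_def P_def by (rule horner_sum_hyp_term_tendsto_0) (use v in auto)
  \<comment> \<open>The extra factors v (v + 1), v and 1 are Gamma(v + 2), Gamma(v + 1) and
    Gamma(v), divided by Gamma(v).\<close>
  have tel: "(v + 1)\<^sup>2 * (v * (v + 1)) * A k + (11 * v\<^sup>2 + 11 * v + 3) * v * B k - v\<^sup>2 * C k
      = G (Suc k) - G k" for k
  proof -
    \<comment> \<open>Lowest numerator and highest denominator parameters occurring: every other
      term is a polynomial multiple of \<open>U\<close>, apart from the quotient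
      \<open>x + 1\<close>, which cancels.\<close>
    define U where "U = hyp_term v (2 * v + 4) (2 * v + 4) k"
    define x where "x = real k"
    have A: "A k = (x + v + 1) ^ 3 * (x + v) ^ 3 * U"
      using hyp_term_raise_num[of "v + 1" "2 * v + 4" "2 * v + 4" k] hyp_term_raise_num[of v "2 * v + 4" "2 * v + 4" k] v
      by (simp add: A_def U_def x_def add_ac)
    have down: "hyp_term a (2 * v + 3) (2 * v + 3) k = (x + 2 * v + 3)\<^sup>2 * hyp_term a (2 * v + 4) (2 * v + 4) k"
      "hyp_term a (2 * v + 2) (2 * v + 2) k = (x + 2 * v + 2)\<^sup>2 * hyp_term a (2 * v + 3) (2 * v + 3) k"
      "hyp_term a (2 * v + 1) (2 * v + 1) k = (x + 2 * v + 1)\<^sup>2 * hyp_term a (2 * v + 2) (2 * v + 2) k"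
      "hyp_term a (2 * v) (2 * v) k = (x + 2 * v)\<^sup>2 * hyp_term a (2 * v + 1) (2 * v + 1) k" for a
      using hyp_term_raise_den1[of "2 * v + 3" a "2 * v + 3" k] hyp_term_raise_den2[of "2 * v + 3" a "2 * v + 4" k]
         hyp_term_raise_den1[of "2 * v + 2" a "2 * v + 2" k] hyp_term_raise_den2[of "2 * v + 2" a "2 * v + 3" k]
         hyp_term_raise_den1[of "2 * v + 1" a "2 * v + 1" k] hyp_term_raise_den2[of "2 * v + 1" a "2 * v + 2" k]
         hyp_term_raise_den1[of "2 * v" a "2 * v" k] hyp_term_raise_den2[of "2 * v" a "2 * v + 1" k] v
      by (simp_all add: x_def add_ac power2_eq_square)
    have num: "hyp_term (v + 1) (2 * v + 4) (2 * v + 4) k = (x + v) ^ 3 * U"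
      using hyp_term_raise_num[of v "2 * v + 4" "2 * v + 4" k] v by (simp add: U_def x_def)
    have B: "B k = (x + v) ^ 3 * (x + 2 * v + 2)\<^sup>2 * (x + 2 * v + 3)\<^sup>2 * U"
      by (simp add: B_def down num)
    have C: "C k = (x + 2 * v)\<^sup>2 * (x + 2 * v + 1)\<^sup>2 * (x + 2 * v + 2)\<^sup>2 * (x + 2 * v + 3)\<^sup>2 * U"
      by (simp add: C_def down U_def)
    have Gk: "G k = x * P x * (x + 2 * v + 3)\<^sup>2 * U"
      by (simp add: G_def down U_def x_def)
    have "hyp_term v (2 * v + 3) (2 * v + 3) (Suc k) = (x + v) ^ 3 * U / (x + 1)"
      using hyp_term_Suc[of v "2 * v + 3" "2 * v + 3" k] num by (simp add: x_def add_ac)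
    hence GS: "G (Suc k) = P (x + 1) * (x + v) ^ 3 * U"
      by (simp add: G_def x_def add_ac)
    have "(v + 1)\<^sup>2 * (v * (v + 1)) * ((x + v + 1) ^ 3 * (x + v) ^ 3)
        + (11 * v\<^sup>2 + 11 * v + 3) * v * ((x + v) ^ 3 * (x + 2 * v + 2)\<^sup>2 * (x + 2 * v + 3)\<^sup>2)
        - v\<^sup>2 * ((x + 2 * v)\<^sup>2 * (x + 2 * v + 1)\<^sup>2 * (x + 2 * v + 2)\<^sup>2 * (x + 2 * v + 3)\<^sup>2)
        = P (x + 1) * (x + v) ^ 3 - x * P x * (x + 2 * v + 3)\<^sup>2"
      unfolding P_def horner_sum_simps id_apply by algebra
    from arg_cong[OF this, of "\<lambda>t. t * U"] show ?thesis
      by (simp add: A B C Gk GS algebra_simps)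
  qed
  have sA: "A sums hyp_sum (v + 2) (2 * v + 4) (2 * v + 4)" and
    sB: "B sums hyp_sum (v + 1) (2 * v + 2) (2 * v + 2)" and
    sC: "C sums hyp_sum v (2 * v) (2 * v)"
    unfolding A_def B_def C_def by (intro hyp_sum_sums; use v in simp)+
  have "(\<lambda>k. (v + 1)\<^sup>2 * (v * (v + 1)) * A k + (11 * v\<^sup>2 + 11 * v + 3) * v * B k - v\<^sup>2 * C k) sums (- G 0)"
    by (rule telescope_tendsto_0_sums[OF tel G0])
  moreover have "(\<lambda>k. (v + 1)\<^sup>2 * (v * (v + 1)) * A k + (11 * v\<^sup>2 + 11 * v + 3) * v * B k - v\<^sup>2 * C k) sums
     ((v + 1)\<^sup>2 * (v * (v + 1)) * hyp_sum (v + 2) (2 * v + 4) (2 * v + 4) +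
      (11 * v\<^sup>2 + 11 * v + 3) * v * hyp_sum (v + 1) (2 * v + 2) (2 * v + 2) - v\<^sup>2 * hyp_sum v (2 * v) (2 * v))"
    by (intro sums_add sums_diff sums_mult sA sB sC)
  moreover have "G 0 = 0" by (simp add: G_def)
  ultimately have main: "(v + 1)\<^sup>2 * (v * (v + 1)) * hyp_sum (v + 2) (2 * v + 4) (2 * v + 4) +
      (11 * v\<^sup>2 + 11 * v + 3) * v * hyp_sum (v + 1) (2 * v + 2) (2 * v + 2) = v\<^sup>2 * hyp_sum v (2 * v) (2 * v)"
    using sums_unique2 by fastforce
  have G1: "Gamma (v + 1) = v * Gamma v" "Gamma (v + 1 + 1) = (v + 1) * (v * Gamma v)"
    using Gamma_real_plus1[of v] Gamma_real_plus1[of "v + 1"] v by auto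
  have F_eqs: "apery_F (v + 1) = (v + 1) * (v * Gamma v) * hyp_sum (v + 2) (2 * v + 4) (2 * v + 4)"
    "apery_F v = v * Gamma v * hyp_sum (v + 1) (2 * v + 2) (2 * v + 2)"
    "apery_F (v - 1) = Gamma v * hyp_sum v (2 * v) (2 * v)"
    using G1 by (simp_all add: apery_F_def add_ac)
  show ?thesis using arg_cong[OF main, of "\<lambda>t. Gamma v * t"]
    unfolding F_eqs by (simp add: algebra_simps)
qed

text \<open>The closed form depends on Gamma functions at (m + 1)/2 and m/2 + 1, so a first-order
  relation is to be expected for the step 2 in m.\<close>

lemma watson_L_recurrence:
  assumes m: "m > -1"
  shows "(m + 2)\<^sup>2 * watson_L (m + 2) = (m + 1)\<^sup>2 * watson_L m"
proof -
  \<comment> \<open>Telescoping certificate for the step 2. Its justification is the polynomial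
    identity that closes \<open>tel\<close>; its five coefficients respect the decay bound 5 <
    11/2.\<close>
  define P where "P = (\<lambda>k. horner_sum id k
    [-74 - 279 * m - 413 * m^2 - 300 * m^3 - 107 * m^4 - 15 * m^5,
     -323/2 - 477 * m - 1037/2 * m^2 - 246 * m^3 - 43 * m^4,
     -261/2 - 281 * m - 397/2 * m^2 - 46 * m^3,
     -46 - 64 * m - 22 * m^2, -6 - 4 * m])"
  define G where "G = (\<lambda>k. real k * P (real k) * hyp_term (m + 1) (m + 5/2) (2 * m + 5) k)"
  define A where "A = hyp_term (m + 3) (m + 7/2) (2 * m + 6)"
  define B where "B = hyp_term (m + 1) (m + 3/2) (2 * m + 2)"
  have G0: "G \<longlonglongrightarrow> 0"
    unfolding G_def P_def by (rule horner_sum_hyp_term_tendsto_0) (use m in auto)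
  have tel: "(m + 2)\<^sup>2 * A k - (m + 1)\<^sup>2 * B k = G (Suc k) - G k" for k
  proof -
    define U where "U = hyp_term (m + 1) (m + 7/2) (2 * m + 6) k"
    define x where "x = real k"
    have num: "hyp_term (m + 2) (m + 7/2) (2 * m + 6) k = (x + m + 1) ^ 3 * U"
       "hyp_term (m + 3) (m + 7/2) (2 * m + 6) k = (x + m + 2) ^ 3 * hyp_term (m + 2) (m + 7/2) (2 * m + 6) k"
      using hyp_term_raise_num[of "m + 1" "m + 7/2" "2 * m + 6" k]
        hyp_term_raise_num[of "m + 2" "m + 7/2" "2 * m + 6" k] m by (simp_all add: U_def x_def add_ac)
    have A: "A k = (x + m + 1) ^ 3 * (x + m + 2) ^ 3 * U"
      by (simp add: A_def num)
    have den: "hyp_term (m + 1) (m + 5/2) (2 * m + 5) k = (x + m + 5/2) * (x + 2 * m + 5) * U"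
      using hyp_term_raise_den1[of "m + 5/2" "m + 1" "2 * m + 5" k]
        hyp_term_raise_den2[of "2 * m + 5" "m + 1" "m + 7/2" k] m
      by (simp add: U_def x_def add_ac)
    have "B k = (x + m + 3/2) * (x + 2 * m + 2) * (x + 2 * m + 3) * (x + 2 * m + 4) *
        hyp_term (m + 1) (m + 5/2) (2 * m + 5) k"
      using hyp_term_raise_den1[of "m + 3/2" "m + 1" "2 * m + 2" k]
        hyp_term_raise_den2[of "2 * m + 2" "m + 1" "m + 5/2" k]
        hyp_term_raise_den2[of "2 * m + 3" "m + 1" "m + 5/2" k]
        hyp_term_raise_den2[of "2 * m + 4" "m + 1" "m + 5/2" k] m
      by (simp add: B_def x_def add_ac)
    hence B: "B k = (x + m + 3/2) * (x + m + 5/2) * (x + 2 * m + 2) * (x + 2 * m + 3) * (x + 2 * m + 4) *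
        (x + 2 * m + 5) * U" by (simp add: den)
    have Gk: "G k = x * P x * (x + m + 5/2) * (x + 2 * m + 5) * U"
      by (simp add: G_def den x_def)
    have "hyp_term (m + 1) (m + 5/2) (2 * m + 5) (Suc k) = (x + m + 1) ^ 3 * U / (x + 1)"
      using hyp_term_Suc[of "m + 1" "m + 5/2" "2 * m + 5" k] num by (simp add: x_def add_ac)
    hence GS: "G (Suc k) = P (x + 1) * (x + m + 1) ^ 3 * U"
      by (simp add: G_def x_def add_ac)
    have "(m + 2)\<^sup>2 * ((x + m + 1) ^ 3 * (x + m + 2) ^ 3)
        - (m + 1)\<^sup>2 * ((x + m + 3/2) * (x + m + 5/2) * (x + 2 * m + 2) * (x + 2 * m + 3) * (x + 2 * m + 4) * (x + 2 * m + 5))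
        = P (x + 1) * (x + m + 1) ^ 3 - x * P x * (x + m + 5/2) * (x + 2 * m + 5)"
      unfolding P_def horner_sum_simps id_apply by (simp add: field_simps) algebra
    from arg_cong[OF this, of "\<lambda>t. t * U"] show ?thesis
      by (simp only: A B Gk GS) (simp only: left_diff_distrib mult.assoc)
  qed
  have sA: "A sums hyp_sum (m + 3) (m + 7/2) (2 * m + 6)" and
    sB: "B sums hyp_sum (m + 1) (m + 3/2) (2 * m + 2)"
    unfolding A_def B_def by (intro hyp_sum_sums; use m in simp)+
  have "(\<lambda>k. (m + 2)\<^sup>2 * A k - (m + 1)\<^sup>2 * B k) sums (- G 0)"
    by (rule telescope_tendsto_0_sums[OF tel G0])
  moreover have "(\<lambda>k. (m + 2)\<^sup>2 * A k - (m + 1)\<^sup>2 * B k) sums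
     ((m + 2)\<^sup>2 * hyp_sum (m + 3) (m + 7/2) (2 * m + 6) - (m + 1)\<^sup>2 * hyp_sum (m + 1) (m + 3/2) (2 * m + 2))"
    by (intro sums_diff sums_mult sA sB)
  moreover have "G 0 = 0" by (simp add: G_def)
  ultimately have "(m + 2)\<^sup>2 * hyp_sum (m + 3) (m + 7/2) (2 * m + 6) = (m + 1)\<^sup>2 * hyp_sum (m + 1) (m + 3/2) (2 * m + 2)"
    using sums_unique2 by fastforce
  thus ?thesis by (simp add: watson_L_def algebra_simps)
qed

text \<open>At m = 1 the term itself is a difference of hypergeometric terms, so the sum collapses
  to its boundary value. This anchors the evaluation of \<open>watson_L\<close>. Here
  \<open>G 0\<close> is not zero, and the growth k^(1/2) of \<open>hyp_term 2 (3/2) 3\<close> is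
  beaten by the quotient k + 1.\<close>

lemma watson_L_1: "watson_L 1 = 2"
proof -
  define G where "G = (\<lambda>k. -2 * hyp_term 2 (3/2) 3 k / (real k + 1))"
  have "(\<lambda>k. -2 * (hyp_term 2 (3/2) 3 k / real k powr (1/2) * (real k powr (1/2) / (real k + 1)))) \<longlonglongrightarrow> -2 * (1 * 0)"
  proof (intro tendsto_mult tendsto_const)
    show "(\<lambda>k. hyp_term 2 (3/2) 3 k / real k powr (1/2)) \<longlonglongrightarrow> 1"
      using hyp_term_asymp[of 2 "3/2" 3] by simp
    show "(\<lambda>k. real k powr (1/2) / (real k + 1)) \<longlonglongrightarrow> 0" by real_asymp
  qed
  moreover have "eventually (\<lambda>k. -2 * (hyp_term 2 (3/2) 3 k / real k powr (1/2) * (real k powr (1/2) / (real k + 1)))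
     = G k) sequentially"
    using eventually_gt_at_top[of 0] by eventually_elim (simp add: G_def)
  ultimately have G0: "G \<longlonglongrightarrow> 0"
    using Lim_transform_eventually by fastforce
  have tel: "hyp_term 2 (5/2) 4 k = G (Suc k) - G k" for k
  proof -
    define U where "U = hyp_term 2 (5/2) 4 k"
    define x where "x = real k"
    have x: "x \<ge> 0" by (simp add: x_def)
    have Gk: "G k = -2 * (x + 3/2) * (x + 3) * U / (x + 1)"
      using hyp_term_raise_den1[of "3/2" 2 3 k] hyp_term_raise_den2[of 3 2 "5/2" k]
      by (simp add: G_def U_def x_def field_simps)
    have "hyp_term 2 (3/2) 3 (Suc k) = (x + 2) ^ 3 * U / (x + 1)"
      using hyp_term_raise_num[of 2 "5/2" 4 k] hyp_term_Suc[of 2 "3/2" 3 k]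
      by (simp add: U_def x_def)
    hence GS: "G (Suc k) = -2 * (x + 2) ^ 2 * U / (x + 1)"
      using x by (simp add: G_def x_def add_ac power3_eq_cube power2_eq_square)
    have "(x + 1) * U = -2 * (x + 2) ^ 2 * U - -2 * (x + 3/2) * (x + 3) * U"
      by (simp add: field_simps power2_eq_square)
    hence "U = (-2 * (x + 2) ^ 2 * U - -2 * (x + 3/2) * (x + 3) * U) / (x + 1)"
      using x by (simp add: eq_divide_eq mult.commute)
    hence "U = G (Suc k) - G k"
      unfolding Gk GS by (simp only: diff_divide_distrib)
    thus ?thesis by (simp add: U_def)
  qed
  have "hyp_sum 2 (5/2) 4 = - G 0"
    using telescope_tendsto_0_sums[OF tel G0] hyp_sum_sums[of 2 "5/2" 4] sums_unique2 by fastforce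
  also have "\<dots> = 2 / sqrt pi"
  proof -
    have "Gamma (2::real) = 1" "Gamma (3::real) = 2"
      using Gamma_fact[of 1, where 'a = real] Gamma_fact[of 2, where 'a = real] by simp_all
    thus ?thesis by (simp add: G_def hyp_term_def Gamma_three_halves)
  qed
  finally show ?thesis by (simp add: watson_L_def)
qed

text \<open>Both are 3F2(1/2, 1/2, 1/2; 1, 1; 1). For equal arguments the parameters of the two
  families agree only here, since v + 3/2 = 2v + 2 forces v = -1/2.\<close>

lemma apery_F_minus_half: "apery_F (-1/2) = watson_L (-1/2)"
  using Gamma_one_half_real by (simp add: apery_F_def watson_L_def)

text \<open>
  Watson's theorem evaluates \<open>watson_L\<close> in closed form, unlike the contiguous sum \<open>apery_F (1/2)\<close>.
\<close>

lemma apery_F_half: "apery_F (1/2) = 5/2 * watson_L (1/2) - apery_F (-1/2) / 2"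
proof -
  define P :: "real \<Rightarrow> real" where "P = (\<lambda>k. horner_sum id k [2, 11/2, 4])"
  define G where "G = (\<lambda>k. real k * P (real k) * hyp_term (1/2) 2 2 k)"
  define A where "A = hyp_term (3/2) 3 3"
  define B where "B = hyp_term (3/2) 2 3"
  define C where "C = hyp_term (1/2) 1 1"
  have G0: "G \<longlonglongrightarrow> 0"
    unfolding G_def P_def by (rule horner_sum_hyp_term_tendsto_0) auto
  \<comment> \<open>With these weights the combination of the three contiguous terms is a
    difference. The 1/2 on \<open>A\<close> is Gamma(3/2) / \<open>sqrt pi\<close>, so no further
    normalisation is needed.\<close>
  have tel: "A k / 2 - 5/2 * B k + C k / 2 = G (Suc k) - G k" for k
  proof -
    define U where "U = hyp_term (1/2) 3 3 k"
    define x where "x = real k"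
    have A: "A k = (x + 1/2) ^ 3 * U"
      using hyp_term_raise_num[of "1/2" 3 3 k] by (simp add: A_def U_def x_def)
    have B: "B k = (x + 2) * (x + 1/2) ^ 3 * U"
      using hyp_term_raise_den1[of 2 "3/2" 3 k] A by (simp add: A_def B_def x_def)
    have d22: "hyp_term (1/2) 2 2 k = (x + 2)\<^sup>2 * U"
      using hyp_term_raise_den1[of 2 "1/2" 2 k] hyp_term_raise_den2[of 2 "1/2" 3 k]
      by (simp add: U_def x_def power2_eq_square)
    have C: "C k = (x + 1)\<^sup>2 * (x + 2)\<^sup>2 * U"
      using hyp_term_raise_den1[of 1 "1/2" 1 k] hyp_term_raise_den2[of 1 "1/2" 2 k] d22
      by (simp add: C_def x_def power2_eq_square)
    have Gk: "G k = x * P x * (x + 2)\<^sup>2 * U"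
      by (simp add: G_def d22 x_def)
    have "hyp_term (1/2) 2 2 (Suc k) = (x + 1/2) ^ 3 * U / (x + 1)"
      using hyp_term_Suc[of "1/2" 2 2 k] A by (simp add: A_def x_def)
    hence GS: "G (Suc k) = P (x + 1) * (x + 1/2) ^ 3 * U"
      by (simp add: G_def x_def add_ac)
    have "(x + 1/2) ^ 3 / 2 - 5/2 * ((x + 2) * (x + 1/2) ^ 3) + (x + 1)\<^sup>2 * (x + 2)\<^sup>2 / 2
        = P (x + 1) * (x + 1/2) ^ 3 - x * P x * (x + 2)\<^sup>2"
      unfolding P_def horner_sum_simps id_apply by (simp add: field_simps) algebra
    from arg_cong[OF this, of "\<lambda>t. t * U"] show ?thesis
      by (simp add: A B C Gk GS algebra_simps)
  qed
  have sA: "A sums hyp_sum (3/2) 3 3" and sB: "B sums hyp_sum (3/2) 2 3" and sC: "C sums hyp_sum (1/2) 1 1"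
    unfolding A_def B_def C_def by (intro hyp_sum_sums; simp)+
  have "(\<lambda>k. A k / 2 - 5/2 * B k + C k / 2) sums (- G 0)"
    by (rule telescope_tendsto_0_sums[OF tel G0])
  moreover have "(\<lambda>k. A k / 2 - 5/2 * B k + C k / 2) sums
      (hyp_sum (3/2) 3 3 / 2 - 5/2 * hyp_sum (3/2) 2 3 + hyp_sum (1/2) 1 1 / 2)"
    by (intro sums_add sums_diff sums_mult sums_divide sA sB sC)
  moreover have "G 0 = 0" by (simp add: G_def)
  ultimately have main: "hyp_sum (3/2) 3 3 / 2 - 5/2 * hyp_sum (3/2) 2 3 + hyp_sum (1/2) 1 1 / 2 = 0"
    using sums_unique2 by fastforce
  have "apery_F (1/2) = sqrt pi * (hyp_sum (3/2) 3 3 / 2)" "watson_L (1/2) = sqrt pi * hyp_sum (3/2) 2 3"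
    "apery_F (-1/2) = sqrt pi * hyp_sum (1/2) 1 1"
    using Gamma_one_half_real by (simp_all add: apery_F_def watson_L_def Gamma_three_halves)
  thus ?thesis using arg_cong[OF main, of "\<lambda>t. sqrt pi * t"] by (simp add: algebra_simps)
qed

section \<open>Integral representations and Watson's theorem\<close>

text \<open>Integrand of the double Euler integral for 3F2. Values in \<open>ennreal\<close> let
  sums and integrals be exchanged without integrability proofs.\<close>

definition euler_kernel :: "real \<Rightarrow> real \<Rightarrow> real \<Rightarrow> real \<Rightarrow> real \<Rightarrow> real \<times> real \<Rightarrow> ennreal" where
  "euler_kernel a b a' b' c = (\<lambda>(x, y). ennreal (x powr (a - 1) * (1 - x) powr (b - 1) *
     (y powr (a' - 1) * (1 - y) powr (b' - 1)) * (1 - x * y) powr (-c)) *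
     (indicator {0<..<1} x * indicator {0<..<1} y))"

lemma nn_integral_Beta:
  assumes "a > 0" "b > 0"
  shows "(\<integral>\<^sup>+x. ennreal (x powr (a - 1) * (1 - x) powr (b - 1)) * indicator {0<..<1} x \<partial>lborel) = ennreal (Beta a b)"
  using has_integral_Beta_real[OF assms]
  by (intro nn_integral_has_integral_lebesgue') (auto simp: has_integral_Icc_iff_Ioo)

lemma binomial_series_neg_powr:
  fixes c z :: real
  assumes "0 \<le> z" "z < 1"
  shows "(\<lambda>k. pochhammer c k / fact k * z ^ k) sums (1 - z) powr (-c)"
proof -
  have "(\<lambda>k. ((-c) gchoose k) * (-z) ^ k) sums (1 + (-z)) powr (-c)"
    using assms by (intro gen_binomial_real) auto
  moreover have "((-c) gchoose k) * (-z) ^ k = pochhammer c k / fact k * z ^ k" for k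
  proof -
    have "(-1) ^ k * (-z) ^ k = z ^ k" by (simp flip: power_mult_distrib)
    thus ?thesis by (simp add: gbinomial_pochhammer mult.assoc mult.left_commute[of "(-1) ^ k"])
  qed
  ultimately show ?thesis by simp
qed

text \<open>Expanding (1 - xy)^(-c) by the binomial series separates the variables, and each term is
  a product of two Beta integrals. All coefficients are nonnegative because c > 0.\<close>

lemma nn_integral_euler_kernel:
  assumes pos: "a > 0" "b > 0" "a' > 0" "b' > 0" "c > 0"
  shows "(\<integral>\<^sup>+p. euler_kernel a b a' b' c p \<partial>(lborel \<Otimes>\<^sub>M lborel)) =
    (\<Sum>k. ennreal (pochhammer c k / fact k * Beta (a + real k) b * Beta (a' + real k) b'))"
proof -
  define f where "f = (\<lambda>k x. ennreal (x powr (a + real k - 1) * (1 - x) powr (b - 1)) * indicator {0<..<1} x)"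
  define g where "g = (\<lambda>k y. ennreal (y powr (a' + real k - 1) * (1 - y) powr (b' - 1)) * indicator {0<..<1} y)"
  define w where "w = (\<lambda>k. pochhammer c k / fact k)"
  have w: "w k \<ge> 0" for k
    using pos by (simp add: w_def pochhammer_nonneg)
  have [measurable]: "f k \<in> borel_measurable lborel" "g k \<in> borel_measurable lborel" for k
    unfolding f_def g_def by measurable
  have K: "euler_kernel a b a' b' c (x, y) = (\<Sum>k. ennreal (w k) * (f k x * g k y))" for x y
  proof (cases "x \<in> {0<..<1} \<and> y \<in> {0<..<1}")
    case False
    thus ?thesis by (auto simp: euler_kernel_def f_def g_def)
  next
    case True
    hence xy: "0 < x * y" "x * y < 1"
      using mult_strict_mono[of x 1 y 1] by auto
    define h where "h = x powr (a - 1) * (1 - x) powr (b - 1) * (y powr (a' - 1) * (1 - y) powr (b' - 1))"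
    have h: "h \<ge> 0" by (simp add: h_def)
    have "(\<lambda>k. h * (w k * (x * y) ^ k)) sums (h * (1 - x * y) powr (-c))"
      unfolding w_def using xy by (intro sums_mult binomial_series_neg_powr) auto
    hence "(\<Sum>k. ennreal (h * (w k * (x * y) ^ k))) = ennreal (h * (1 - x * y) powr (-c))"
      using h w xy by (intro suminf_ennreal_eq) auto
    moreover have "ennreal (h * (w k * (x * y) ^ k)) = ennreal (w k) * (f k x * g k y)" for k
    proof -
      have "x powr (a + real k - 1) = x powr (a - 1) * x ^ k" "y powr (a' + real k - 1) = y powr (a' - 1) * y ^ k"
        using True by (simp_all add: powr_add[symmetric] powr_realpow[symmetric] algebra_simps)
      thus ?thesis using True w
        by (simp add: f_def g_def h_def ennreal_mult[symmetric] power_mult_distrib mult_ac)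
    qed
    ultimately show ?thesis using True by (simp add: euler_kernel_def h_def)
  qed
  have term_integral: "(\<integral>\<^sup>+p. ennreal (w k) * (f k (fst p) * g k (snd p)) \<partial>(lborel \<Otimes>\<^sub>M lborel)) =
      ennreal (pochhammer c k / fact k * Beta (a + real k) b * Beta (a' + real k) b')" for k
  proof -
    have nonneg: "Beta (a + real k) b \<ge> 0" "Beta (a' + real k) b' \<ge> 0"
      using pos by (auto simp: Beta_def intro!: divide_nonneg_nonneg mult_nonneg_nonneg less_imp_le[OF Gamma_real_pos])
    have "(\<integral>\<^sup>+p. ennreal (w k) * (f k (fst p) * g k (snd p)) \<partial>(lborel \<Otimes>\<^sub>M lborel)) =
       ennreal (w k) * (\<integral>\<^sup>+p. f k (fst p) * g k (snd p) \<partial>(lborel \<Otimes>\<^sub>M lborel))"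
      by (rule nn_integral_cmult) measurable
    also have "(\<integral>\<^sup>+p. f k (fst p) * g k (snd p) \<partial>(lborel \<Otimes>\<^sub>M lborel)) =
       (\<integral>\<^sup>+x. \<integral>\<^sup>+y. f k x * g k y \<partial>lborel \<partial>lborel)"
      by (subst lborel.nn_integral_fst[symmetric]) auto
    also have "\<dots> = ennreal (Beta (a + real k) b) * ennreal (Beta (a' + real k) b')"
    proof -
      have "(\<integral>\<^sup>+x. f k x \<partial>lborel) = ennreal (Beta (a + real k) b)"
        "(\<integral>\<^sup>+y. g k y \<partial>lborel) = ennreal (Beta (a' + real k) b')"
        unfolding f_def g_def using pos by (auto intro!: nn_integral_Beta)
      thus ?thesis by (simp add: nn_integral_cmult nn_integral_multc)
    qed
    finally show ?thesis using nonneg w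
      by (simp add: w_def ennreal_mult[symmetric] mult.assoc)
  qed
  have "(\<integral>\<^sup>+p. euler_kernel a b a' b' c p \<partial>(lborel \<Otimes>\<^sub>M lborel)) =
      (\<integral>\<^sup>+p. (\<Sum>k. ennreal (w k) * (f k (fst p) * g k (snd p))) \<partial>(lborel \<Otimes>\<^sub>M lborel))"
    by (intro nn_integral_cong) (auto simp: K)
  also have "\<dots> = (\<Sum>k. \<integral>\<^sup>+p. ennreal (w k) * (f k (fst p) * g k (snd p)) \<partial>(lborel \<Otimes>\<^sub>M lborel))"
    by (rule nn_integral_suminf) measurable
  also have "\<dots> = (\<Sum>k. ennreal (pochhammer c k / fact k * Beta (a + real k) b * Beta (a' + real k) b'))"
    by (simp only: term_integral)
  finally show ?thesis .
qed

lemma apery_F_integral: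
  assumes v: "v > -1"
  shows "(\<integral>\<^sup>+p. euler_kernel (v + 1) (v + 1) (v + 1) (v + 1) (v + 1) p \<partial>(lborel \<Otimes>\<^sub>M lborel)) = ennreal (apery_F v)"
proof -
  have G: "Gamma (v + 1) > 0" using v by (intro Gamma_real_pos) auto
  have t: "pochhammer (v + 1) k / fact k * Beta (v + 1 + real k) (v + 1) * Beta (v + 1 + real k) (v + 1)
     = Gamma (v + 1) * hyp_term (v + 1) (2 * v + 2) (2 * v + 2) k" for k
  proof -
    have "pochhammer (v + 1) k = Gamma (real k + (v + 1)) / Gamma (v + 1)"
      using v by (subst pochhammer_Gamma) (auto simp: add_ac)
    moreover have "Beta (v + 1 + real k) (v + 1) = Gamma (real k + (v + 1)) * Gamma (v + 1) / Gamma (real k + (2 * v + 2))"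
      by (simp add: Beta_def add_ac)
    ultimately show ?thesis using G by (simp add: hyp_term_def power3_eq_cube)
  qed
  have pos: "hyp_term (v + 1) (2 * v + 2) (2 * v + 2) k \<ge> 0" for k
    using hyp_term_pos[of "v + 1" "2 * v + 2" "2 * v + 2" k] v by auto
  have "(\<lambda>k. Gamma (v + 1) * hyp_term (v + 1) (2 * v + 2) (2 * v + 2) k) sums apery_F v"
    unfolding apery_F_def using v by (intro sums_mult hyp_sum_sums) auto
  hence "(\<Sum>k. ennreal (Gamma (v + 1) * hyp_term (v + 1) (2 * v + 2) (2 * v + 2) k)) = ennreal (apery_F v)"
    using G pos by (intro suminf_ennreal_eq) auto
  thus ?thesis using v nn_integral_euler_kernel[of "v + 1" "v + 1" "v + 1" "v + 1" "v + 1"]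
    by (simp only: t)
qed

text \<open>The exponent parameter 1/2 is the difference (m + 3/2) - (m + 1) of a denominator and a
  numerator parameter. The integral is wanted only for monotonicity in m.\<close>

lemma watson_L_integral:
  assumes m: "m > -1"
  shows "(\<integral>\<^sup>+p. euler_kernel (m + 1) (1/2) (m + 1) (m + 1) (m + 1) p \<partial>(lborel \<Otimes>\<^sub>M lborel)) = ennreal (watson_L m)"
proof -
  have G: "Gamma (m + 1) > 0" using m by (intro Gamma_real_pos) auto
  have t: "pochhammer (m + 1) k / fact k * Beta (m + 1 + real k) (1/2) * Beta (m + 1 + real k) (m + 1)
     = sqrt pi * hyp_term (m + 1) (m + 3/2) (2 * m + 2) k" for k
  proof -
    have "pochhammer (m + 1) k = Gamma (real k + (m + 1)) / Gamma (m + 1)"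
      using m by (subst pochhammer_Gamma) (auto simp: add_ac)
    moreover have "Beta (m + 1 + real k) (m + 1) = Gamma (real k + (m + 1)) * Gamma (m + 1) / Gamma (real k + (2 * m + 2))"
      by (simp add: Beta_def add_ac)
    moreover have "m + 1 + real k + 1/2 = real k + (m + 3/2)" by simp
    hence "Beta (m + 1 + real k) (1/2) = Gamma (real k + (m + 1)) * sqrt pi / Gamma (real k + (m + 3/2))"
      unfolding Beta_def using Gamma_one_half_real by (simp only: add_ac)
    ultimately show ?thesis using G by (simp add: hyp_term_def power3_eq_cube)
  qed
  have pos: "hyp_term (m + 1) (m + 3/2) (2 * m + 2) k \<ge> 0" for k
    using hyp_term_pos[of "m + 1" "m + 3/2" "2 * m + 2" k] m by auto
  have "(\<lambda>k. sqrt pi * hyp_term (m + 1) (m + 3/2) (2 * m + 2) k) sums watson_L m"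
    unfolding watson_L_def using m by (intro sums_mult hyp_sum_sums) auto
  hence "(\<Sum>k. ennreal (sqrt pi * hyp_term (m + 1) (m + 3/2) (2 * m + 2) k)) = ennreal (watson_L m)"
    using pos by (intro suminf_ennreal_eq) auto
  thus ?thesis using m nn_integral_euler_kernel[of "m + 1" "1/2" "m + 1" "m + 1" "m + 1"]
    by (simp only: t)
qed

lemma hyp_sum_pos: "a > 0 \<Longrightarrow> d > 0 \<Longrightarrow> e > 0 \<Longrightarrow> d + e - 3 * a > 0 \<Longrightarrow> hyp_sum a d e > 0"
  unfolding hyp_sum_def by (intro suminf_pos summable_hyp_term hyp_term_pos)

lemma apery_F_pos: "v > -1 \<Longrightarrow> apery_F v > 0"
  unfolding apery_F_def by (intro mult_pos_pos Gamma_real_pos hyp_sum_pos) auto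

lemma watson_L_pos: "m > -1 \<Longrightarrow> watson_L m > 0"
  unfolding watson_L_def by (intro mult_pos_pos hyp_sum_pos) auto

text \<open>The integrand is a factor free of m times \<open>g powr m\<close> with 0 < g \<le> 1,
  hence decreasing in m pointwise. The bound on \<open>g\<close> comes from 1 - y \<le> 1 -
  xy.\<close>

lemma watson_L_antimono:
  assumes m: "-1 < m" "m \<le> m'"
  shows "watson_L m' \<le> watson_L m"
proof -
  have "ennreal (watson_L m') \<le> ennreal (watson_L m)"
    unfolding watson_L_integral[OF m(1), symmetric] watson_L_integral[OF less_le_trans[OF m], symmetric]
  proof (rule nn_integral_mono)
    fix p :: "real \<times> real"
    obtain x y where p: "p = (x, y)" by force
    show "euler_kernel (m' + 1) (1/2) (m' + 1) (m' + 1) (m' + 1) p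
        \<le> euler_kernel (m + 1) (1/2) (m + 1) (m + 1) (m + 1) p"
    proof (cases "x \<in> {0<..<1} \<and> y \<in> {0<..<1}")
      case False
      thus ?thesis by (auto simp: euler_kernel_def p)
    next
      case True
      define g where "g = x * (y * (1 - y)) / (1 - x * y)"
      have xy: "0 < x * y" "x * y < 1"
        using mult_strict_mono[of x 1 y 1] True by auto
      have "x * (y * (1 - y)) \<le> 1 * (1 * (1 - x * y))"
        using True mult_right_mono[of x 1 y] by (intro mult_mono) auto
      hence g: "0 < g" "g \<le> 1"
        using True xy by (auto simp: g_def field_simps)
      have eq: "x powr m * (1 - x) powr (-1/2) * (y powr m * (1 - y) powr m) * (1 - x * y) powr (-m - 1)
         = (1 - x) powr (-1/2) / (1 - x * y) * g powr m" for m
        using True xy by (simp add: g_def powr_mult powr_divide powr_diff powr_minus divide_simps)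
      have "g powr m' \<le> g powr m"
        using g m by (intro powr_mono') auto
      hence "(1 - x) powr (-1/2) / (1 - x * y) * g powr m' \<le> (1 - x) powr (-1/2) / (1 - x * y) * g powr m"
        using xy by (intro mult_left_mono) auto
      hence "x powr m' * (1 - x) powr (-1/2) * (y powr m' * (1 - y) powr m') * (1 - x * y) powr (-m' - 1)
        \<le> x powr m * (1 - x) powr (-1/2) * (y powr m * (1 - y) powr m) * (1 - x * y) powr (-m - 1)"
        unfolding eq .
      thus ?thesis using True by (simp add: euler_kernel_def p)
    qed
  qed
  thus ?thesis using watson_L_pos[OF m(1)] by (simp add: ennreal_le_iff)
qed

text \<open>A step of 2 in m is a unit step in (m + 1)/2. Squared, the relation becomes the
  recurrence of \<open>watson_L\<close>.\<close>

lemma Beta_half_step: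
  assumes "m > -1"
  shows "(m + 2) * Beta ((m + 2 + 1) / 2) (1/2) = (m + 1) * Beta ((m + 1) / 2) (1/2 :: real)"
proof -
  have "(m + 1) / 2 \<notin> \<int>\<^sub>\<le>\<^sub>0" using assms by auto
  from Beta_plus1_left[OF this, of "1/2"] show ?thesis by (simp add: field_simps)
qed

lemma Beta_real_pos: "a > 0 \<Longrightarrow> b > 0 \<Longrightarrow> Beta a b > (0 :: real)"
  unfolding Beta_def by (intro divide_pos_pos mult_pos_pos Gamma_real_pos) auto

text \<open>
  Both sides are decreasing and obey the same recurrence of step 2, so their ratio, known at 1,
  is squeezed along \<open>m + 2n\<close>.
\<close>

lemma watson_L_eq_Beta:
  assumes m: "-1 < m" "m \<le> 1"
  shows "watson_L m = Beta ((m + 1) / 2) (1/2) ^ 2 / 2"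
proof -
  define B where "B = (\<lambda>m. Beta ((m + 1) / 2) (1/2 :: real))"
  define R where "R = (\<lambda>m. watson_L m / B m ^ 2)"
  have Bpos: "B m > 0" if "m > -1" for m
    unfolding B_def using that by (intro Beta_real_pos) auto
  have B_step: "B (m + 2) = (m + 1) / (m + 2) * B m" if "m > -1" for m
    using Beta_half_step[OF that] that by (simp add: B_def field_simps)
  have L_step: "watson_L (m + 2) = ((m + 1) / (m + 2))\<^sup>2 * watson_L m" if "m > -1" for m
    using watson_L_recurrence[OF that] that by (simp add: field_simps)
  have "R (m + 2 * real n) = R m" if "m > -1" for m n
  proof (induction n)
    case (Suc n)
    have "m + 2 * real n > -1" using that by (simp add: add_strict_increasing2)
    from L_step[OF this] B_step[OF this] this have "R (m + 2 * real n + 2) = R (m + 2 * real n)"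
      using Bpos[of "m + 2 * real n"] by (simp add: R_def power_mult_distrib power_divide del: of_nat_add)
    thus ?case using Suc by (simp add: algebra_simps)
  qed auto
  note R_shift = this
  have "B 1 = 2"
    unfolding B_def Beta_def using Gamma_one_half_real by (simp add: Gamma_three_halves)
  hence R1: "R 1 = 1/2" by (simp add: R_def watson_L_1)
  have B_mono: "B m' \<le> B m" if "-1 < m" "m \<le> m'" for m m'
    unfolding B_def using that by (intro Beta_real_mono) auto
  \<comment> \<open>Because -1 < m \<le> 1, the point m + 2 (n + 1) lies between the odd numbers s =
    2n + 1 and s + 2, where the ratio is known to be 1/2. Bounding numerator and denominator at
    opposite ends costs a factor that tends to 1.\<close>
  have upper: "R m \<le> 1/2 * ((2 * real n + 3) / (2 * real n + 2))\<^sup>2" for n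
  proof -
    define s where "s = 1 + 2 * real n"
    have s: "s \<ge> 1" by (simp add: s_def)
    have Rs: "watson_L s = 1/2 * B s ^ 2"
    proof -
      have "R s = 1/2" using R_shift[of 1 n] R1 by (simp add: s_def)
      thus ?thesis using Bpos[of s] s by (simp add: R_def divide_eq_eq)
    qed
    have "R m = watson_L (m + 2 * real (Suc n)) / B (m + 2 * real (Suc n)) ^ 2"
      using R_shift[of m "Suc n"] m by (simp add: R_def)
    also have "\<dots> \<le> watson_L s / B (s + 2) ^ 2"
    proof (rule frac_le)
      show "watson_L s \<ge> 0" using watson_L_pos[of s] s by simp
      show "watson_L (m + 2 * real (Suc n)) \<le> watson_L s"
        by (rule watson_L_antimono) (use m s in \<open>auto simp: s_def\<close>)
      show "B (s + 2) ^ 2 > 0" using Bpos[of "s + 2"] s by simp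
      have "B (s + 2) \<le> B (m + 2 * real (Suc n))"
        by (rule B_mono) (use m s in \<open>auto simp: s_def\<close>)
      thus "B (s + 2) ^ 2 \<le> B (m + 2 * real (Suc n)) ^ 2"
        using Bpos[of "s + 2"] s by (intro power_mono) auto
    qed
    also have "\<dots> = 1/2 * ((s + 2) / (s + 1))\<^sup>2"
    proof -
      define q where "q = (s + 1) / (s + 2)"
      have "watson_L s / B (s + 2) ^ 2 = 1/2 * (1 / q)\<^sup>2"
        using B_step[of s] s Bpos[of s] by (simp add: Rs power_mult_distrib power_divide flip: q_def)
      thus ?thesis by (simp add: q_def)
    qed
    also have "(s + 2) / (s + 1) = (2 * real n + 3) / (2 * real n + 2)"
      by (simp add: s_def add_ac)
    finally show ?thesis .
  qed
  have lower: "R m \<ge> 1/2 * ((2 * real n + 2) / (2 * real n + 3))\<^sup>2" for n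
  proof -
    define s where "s = 1 + 2 * real n"
    have s: "s \<ge> 1" by (simp add: s_def)
    have Rs: "watson_L (s + 2) = 1/2 * B (s + 2) ^ 2"
    proof -
      have "1 + 2 * real (Suc n) = s + 2" by (simp add: s_def)
      hence "R (s + 2) = 1/2" using R_shift[of 1 "Suc n"] R1 by (simp only:)
      thus ?thesis using Bpos[of "s + 2"] s by (simp add: R_def divide_eq_eq)
    qed
    have "1/2 * ((s + 1) / (s + 2))\<^sup>2 = watson_L (s + 2) / B s ^ 2"
      using B_step[of s] Rs s Bpos[of s] by (simp add: power_mult_distrib power_divide)
    also have "\<dots> \<le> watson_L (m + 2 * real (Suc n)) / B (m + 2 * real (Suc n)) ^ 2"
    proof (rule frac_le)
      show "watson_L (m + 2 * real (Suc n)) \<ge> 0" using watson_L_pos[of "m + 2 * real (Suc n)"] m by simp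
      show "watson_L (s + 2) \<le> watson_L (m + 2 * real (Suc n))"
        by (rule watson_L_antimono) (use m s in \<open>auto simp: s_def\<close>)
      show "B (m + 2 * real (Suc n)) ^ 2 > 0" using Bpos[of "m + 2 * real (Suc n)"] m by simp
      have "B (m + 2 * real (Suc n)) \<le> B s"
        by (rule B_mono) (use m s in \<open>auto simp: s_def\<close>)
      thus "B (m + 2 * real (Suc n)) ^ 2 \<le> B s ^ 2"
        using Bpos[of "m + 2 * real (Suc n)"] m by (intro power_mono) auto
    qed
    also have "\<dots> = R m"
      using R_shift[of m "Suc n"] m by (simp add: R_def)
    finally show ?thesis by (simp add: s_def add_ac)
  qed
  have "(\<lambda>n. 1/2 * ((2 * real n + 3) / (2 * real n + 2))\<^sup>2) \<longlonglongrightarrow> 1/2" by real_asymp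
  hence "R m \<le> 1/2" using upper by (intro LIMSEQ_le_const) auto
  moreover have "(\<lambda>n. 1/2 * ((2 * real n + 2) / (2 * real n + 3))\<^sup>2) \<longlonglongrightarrow> 1/2" by real_asymp
  hence "R m \<ge> 1/2" using lower by (intro LIMSEQ_le_const2) auto
  ultimately have "R m = 1/2" by simp
  hence "watson_L m = 1/2 * B m ^ 2"
    unfolding R_def using Bpos[OF m(1)] by (subst (asm) divide_eq_eq) auto
  thus ?thesis by (simp add: B_def)
qed

section \<open>Initial values in terms of Gamma(1/4) and Gamma(3/4)\<close>

lemma apery_F_minus_half_value: "apery_F (-1/2) = pi / 2 * (Gamma (1/4) / Gamma (3/4)) ^ 2"
  using watson_L_eq_Beta[of "-1/2"] Gamma_one_half_real apery_F_minus_half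
  by (simp add: Beta_def power_mult_distrib power_divide mult_ac)

text \<open>The Watson sums at -1/2 and 1/2 involve inverse Gamma quotients: the first is a multiple
  of w^2, the second of 1/w^2, because Gamma(5/4) = Gamma(1/4)/4. Their quotient therefore brings in
  w^4, the value of the continued fraction.\<close>

lemma apery_F_half_value: "apery_F (1/2) = (40 / (Gamma (1/4) / Gamma (3/4)) ^ 4 - 1/2) * apery_F (-1/2)"
proof -
  define w where "w = Gamma (1/4) / Gamma (3/4 :: real)"
  have pos: "Gamma (1/4 :: real) > 0" "Gamma (3/4 :: real) > 0" by (auto intro!: Gamma_real_pos)
  have G54: "Gamma (5/4 :: real) = Gamma (1/4) / 4"
    using Gamma_real_plus1[of "1/4"] by simp
  have "watson_L (1/2) = (Gamma (3/4) * sqrt pi / Gamma (5/4)) ^ 2 / 2"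
    using watson_L_eq_Beta[of "1/2"] Gamma_one_half_real by (simp add: Beta_def)
  hence "watson_L (1/2) = 8 * pi / w\<^sup>2"
    using pos unfolding G54 by (simp add: power_mult_distrib power_divide w_def mult_ac)
  moreover have "w > 0" using pos by (simp add: w_def)
  moreover have "apery_F (-1/2) = pi / 2 * w\<^sup>2"
    unfolding w_def by (rule apery_F_minus_half_value)
  ultimately have "40 / w ^ 4 * apery_F (-1/2) = 5/2 * watson_L (1/2)"
    by (simp add: field_simps power2_eq_square power4_eq_xxxx)
  thus ?thesis unfolding w_def[symmetric] apery_F_half by (simp add: left_diff_distrib)
qed

section \<open>Laplace's method\<close>

definition phi :: real where "phi = (1 + sqrt 5) / 2"

lemma phi_gt_1: "phi > 1"
proof -
  have "sqrt 5 > sqrt 1" by (subst real_sqrt_less_iff) simp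
  thus ?thesis by (simp add: phi_def)
qed

lemma phi_square: "phi\<^sup>2 = phi + 1"
  by (simp add: phi_def power2_eq_square field_simps)

text \<open>Equal to 1 / phi, and both coordinates of the maximum of \<open>apery_base\<close>: at x
  = \<open>iphi\<close> the best y is 1 / (1 + \<open>iphi\<close>), which is \<open>iphi\<close>
  again.\<close>

definition iphi :: real where "iphi = phi - 1"

lemma iphi_phi: "iphi * phi = 1" "phi * iphi = 1"
  using phi_square by (simp_all add: iphi_def power2_eq_square algebra_simps)

lemma iphi_eq: "iphi = 1 / phi"
  using iphi_phi phi_gt_1 by (simp add: field_simps)

lemma iphi_bounds: "1/2 < iphi" "iphi < 1"
proof -
  have "sqrt 5 > sqrt (2 ^ 2)" by (subst real_sqrt_less_iff) simp
  hence "sqrt 5 > 2" by simp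
  thus "1/2 < iphi" by (simp add: iphi_def phi_def)
  show "iphi < 1" using phi_gt_1 by (simp add: iphi_eq)
qed

lemma iphi_square: "iphi\<^sup>2 = 1 - iphi"
  using phi_square by (simp add: iphi_def power2_eq_square algebra_simps)

lemma sqrt_one_minus_iphi: "sqrt (1 - iphi) = iphi"
  using iphi_bounds by (simp flip: iphi_square)

definition log_ridge :: "real \<Rightarrow> real" where "log_ridge x = ln x + ln (1 - x) - 2 * ln (1 + sqrt (1 - x))"

definition apery_base :: "real \<Rightarrow> real \<Rightarrow> real" where "apery_base x y = x * (1 - x) * (y * (1 - y)) / (1 - x * y)"

lemma xy_less_1: "x \<in> {0<..<1} \<Longrightarrow> y \<in> {0<..<1} \<Longrightarrow> x * y < (1 :: real)"
  using mult_strict_mono[of x 1 y 1] by auto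

lemma exp_log_ridge:
  assumes "x \<in> {0<..<1}"
  shows "exp (log_ridge x) = x * (1 - x) / (1 + sqrt (1 - x))\<^sup>2"
proof -
  have "1 + sqrt (1 - x) > 0" using assms by (simp add: add_pos_nonneg)
  hence "exp (2 * ln (1 + sqrt (1 - x))) = (1 + sqrt (1 - x))\<^sup>2"
    by (simp add: exp_double)
  thus ?thesis using assms by (simp add: log_ridge_def exp_diff exp_add)
qed

lemma exp_log_ridge_iphi: "exp (log_ridge iphi) = 1 / phi ^ 5"
proof -
  have "exp (log_ridge iphi) = iphi * iphi\<^sup>2 / phi\<^sup>2"
    using exp_log_ridge[of iphi] iphi_bounds by (simp add: sqrt_one_minus_iphi iphi_square) (simp add: iphi_def)
  thus ?thesis using phi_gt_1 by (simp add: iphi_eq power_divide power_add[symmetric] eval_nat_numeral)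
qed

text \<open>For fixed \<open>x\<close>, the maximum of \<open>apery_base x\<close> over \<open>y\<close> is \<open>exp (log_ridge x)\<close>, attained at
  \<open>y = 1 / (1 + sqrt (1 - x))\<close>.\<close>

lemma apery_base_factor:
  assumes x: "x \<in> {0<..<1}" and y: "y \<in> {0<..<1}"
  shows "apery_base x y = exp (log_ridge x) * (1 - ((1 + sqrt (1 - x)) * y - 1)\<^sup>2 / (1 - x * y))"
proof -
  define s where "s = sqrt (1 - x)"
  have s: "s > 0" "x = 1 - s\<^sup>2" using x by (simp_all add: s_def)
  have D: "1 - x * y > 0" using xy_less_1[OF x y] by simp
  \<comment> \<open>Completing the square in y is exact once x is written as 1 - s^2. It yields the
    maximum over y and the local behaviour without a Taylor expansion in y.\<close>
  have "1 - ((1 + s) * y - 1)\<^sup>2 / (1 - x * y) = (1 - x * y - ((1 + s) * y - 1)\<^sup>2) / (1 - x * y)"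
    using D by (simp add: field_simps)
  also have "1 - x * y - ((1 + s) * y - 1)\<^sup>2 = (1 + s)\<^sup>2 * (y * (1 - y))"
    unfolding s(2) by (simp add: power2_eq_square algebra_simps)
  finally show ?thesis using s(1) D
    by (simp add: exp_log_ridge[OF x] apery_base_def flip: s_def)
qed

text \<open>In this form the critical point is visible: sqrt (1 - x) = x means x^2 + x = 1, whose
  root in the unit interval is \<open>iphi\<close>.\<close>

lemma log_ridge_has_derivative:
  assumes x: "x \<in> {0<..<1}"
  shows "(log_ridge has_real_derivative (sqrt (1 - x) - x) / (x * (1 - x))) (at x)"
proof -
  define s where "s = sqrt (1 - x)"
  have s: "0 < s" "s < 1" "s * s = 1 - x" using x by (simp_all add: s_def)
  have "(log_ridge has_real_derivative 1 / x - 1 / (1 - x) + 1 / (s * (1 + s))) (at x)"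
    unfolding log_ridge_def s_def using x s(1)
    by (auto intro!: derivative_eq_intros simp: add_pos_pos inverse_eq_divide)
  also have "1 / x - 1 / (1 - x) + 1 / (s * (1 + s)) = (s - x) / (x * (1 - x))"
  proof -
    have "x = (1 - s) * (1 + s)" using s(3) by (simp add: algebra_simps)
    hence "1 / (s * (1 + s)) = (1 - s) * s / (x * (s * s))"
      using s(1,2) by (simp add: divide_simps)
    moreover have "1 / x - 1 / (1 - x) = (1 - x - x) / (x * (1 - x))"
      using x by (simp add: field_simps)
    moreover have "1 - x - x + (1 - s) * s = s - x" using s(3) by (simp add: algebra_simps)
    ultimately show ?thesis unfolding s(3) by (simp only: add_divide_distrib[symmetric])
  qed
  finally show ?thesis by (simp add: s_def)
qed

text \<open>Adding (x - iphi)^2 leaves a function with derivative (iphi - x) q(x), q \<ge> 0, which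
  still rises up to \<open>iphi\<close> and falls afterwards. The curvature need not be sharp, since
  the bound only serves for domination.\<close>

lemma log_ridge_le_quadratic:
  assumes x: "x \<in> {0<..<1}"
  shows "log_ridge x \<le> log_ridge iphi - (x - iphi)\<^sup>2"
proof -
  define H where "H = (\<lambda>x. log_ridge x + (x - iphi)\<^sup>2)"
  define q where "q = (\<lambda>x. (x + iphi + 1) / ((sqrt (1 - x) + x) * (x * (1 - x))) - 2)"
  have D: "(H has_real_derivative (iphi - x) * q x) (at x)" and q: "q x \<ge> 0"
    if x: "x \<in> {0<..<1}" for x
  proof -
    define s where "s = sqrt (1 - x)"
    have s: "s > 0" "s < 1" "s\<^sup>2 = 1 - x" using x by (simp_all add: s_def)
    have "(s - x) * (s + x) = (iphi - x) * (x + iphi + 1)"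
      using s(3) iphi_square by (simp add: power2_eq_square algebra_simps)
    hence "s - x = (iphi - x) * (x + iphi + 1) / (s + x)"
      using s x by (simp add: field_simps)
    hence "(s - x) / (x * (1 - x)) = (iphi - x) * ((x + iphi + 1) / ((s + x) * (x * (1 - x))))"
      by simp
    moreover have "(iphi - x) * q x = (iphi - x) * ((x + iphi + 1) / ((s + x) * (x * (1 - x)))) - (iphi - x) * 2"
      by (simp only: q_def s_def right_diff_distrib)
    ultimately have eq: "(s - x) / (x * (1 - x)) + 2 * (x - iphi) = (iphi - x) * q x"
      by (simp add: algebra_simps)
    show "(H has_real_derivative (iphi - x) * q x) (at x)"
      unfolding eq[symmetric] s_def H_def
      by (auto intro!: derivative_eq_intros log_ridge_has_derivative[OF x])
    \<comment> \<open>The denominator in \<open>q\<close> is at most 2 * 1/4 and the numerator at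
      least 1, so the quotient is at least the 2 that is subtracted.\<close>
    have "x * (1 - x) \<le> 1/4" using zero_le_power2[of "x - 1/2"] by (simp add: power2_eq_square algebra_simps)
    hence "(s + x) * (x * (1 - x)) \<le> 2 * (1/4)"
      using s x by (intro mult_mono) auto
    moreover have "(s + x) * (x * (1 - x)) > 0" using s x by simp
    moreover have "x + iphi + 1 \<ge> 1" using x iphi_bounds by simp
    ultimately show "q x \<ge> 0" by (simp add: q_def s_def[symmetric] field_simps)
  qed
  have "H x \<le> H iphi"
  proof (cases "x \<le> iphi")
    case True
    thus ?thesis
    proof (rule DERIV_nonneg_imp_nondecreasing)
      fix u assume "x \<le> u" "u \<le> iphi"
      hence "u \<in> {0<..<1}" using x iphi_bounds by auto
      thus "\<exists>d. (H has_real_derivative d) (at u) \<and> 0 \<le> d"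
        using D[of u] q[of u] \<open>u \<le> iphi\<close> by (intro exI[of _ "(iphi - u) * q u"]) auto
    qed
  next
    case False
    hence "iphi \<le> x" by simp
    thus ?thesis
    proof (rule DERIV_nonpos_imp_nonincreasing)
      fix u assume "iphi \<le> u" "u \<le> x"
      hence "u \<in> {0<..<1}" using x iphi_bounds by auto
      thus "\<exists>d. (H has_real_derivative d) (at u) \<and> d \<le> 0"
        using D[of u] q[of u] \<open>iphi \<le> u\<close>
        by (intro exI[of _ "(iphi - u) * q u"]) (auto intro!: mult_nonpos_nonneg)
    qed
  qed
  thus ?thesis by (simp add: H_def)
qed

lemma apery_base_pos: "x \<in> {0<..<1} \<Longrightarrow> y \<in> {0<..<1} \<Longrightarrow> apery_base x y > 0"
  using xy_less_1[of x y] by (simp add: apery_base_def)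

text \<open>Global integrable bound for dominated convergence: the ridge estimate controls x, and 1
  - z^2 \<le> exp (- z^2) controls the distance z to the ridge.\<close>

lemma apery_base_le_gaussian:
  assumes x: "x \<in> {0<..<1}" and y: "y \<in> {0<..<1}"
  shows "phi ^ 5 * apery_base x y \<le> exp (- ((x - iphi)\<^sup>2 + (y - iphi)\<^sup>2) / 9)"
proof -
  define s where "s = sqrt (1 - x)"
  define z where "z = (1 + s) * y - 1"
  have s: "s > 0" "s < 1" "s\<^sup>2 = 1 - x" using x by (simp_all add: s_def)
  have D: "1 - x * y > 0" "1 - x * y \<le> 1" using xy_less_1[OF x y] x y by auto
  have "1 - z\<^sup>2 / (1 - x * y) \<le> 1 - z\<^sup>2"
    using D by (simp add: pos_le_divide_eq mult_left_le)
  also have "\<dots> \<le> exp (- z\<^sup>2)" using exp_ge_add_one_self[of "- z\<^sup>2"] by simp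
  finally have "apery_base x y \<le> exp (log_ridge x) * exp (- z\<^sup>2)"
    unfolding apery_base_factor[OF x y] z_def s_def by (intro mult_left_mono) auto
  also have "\<dots> \<le> exp (log_ridge iphi - (x - iphi)\<^sup>2) * exp (- z\<^sup>2)"
    using log_ridge_le_quadratic[OF x] by (intro mult_right_mono) auto
  also have "\<dots> = exp (- ((x - iphi)\<^sup>2 + z\<^sup>2)) / phi ^ 5"
    using exp_log_ridge_iphi by (simp add: exp_diff exp_minus exp_add field_simps)
  finally have "phi ^ 5 * apery_base x y \<le> exp (- ((x - iphi)\<^sup>2 + z\<^sup>2))"
    using phi_gt_1 by (simp add: field_simps)
  \<comment> \<open>Passes from the ridge distance z to y - iphi. The slope of the ridge gives |s -
    iphi| \<le> 2 |x - iphi|, hence (y - iphi)^2 \<le> 2 z^2 + 8 (x - iphi)^2; adding (x - iphi)^2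
    gives the constant 9 = 1 + 8.\<close>
  also have "\<dots> \<le> exp (- ((x - iphi)\<^sup>2 + (y - iphi)\<^sup>2) / 9)"
  proof -
    have "(s - iphi) * (s + iphi) = iphi - x"
      using s(3) iphi_square by (simp add: power2_eq_square algebra_simps)
    hence "\<bar>s - iphi\<bar> * (s + iphi) = \<bar>x - iphi\<bar>"
      using s iphi_bounds abs_mult[of "s - iphi" "s + iphi"] by (simp add: abs_minus_commute)
    moreover have "\<bar>s - iphi\<bar> * (1/2) \<le> \<bar>s - iphi\<bar> * (s + iphi)"
      using s iphi_bounds by (intro mult_left_mono) auto
    ultimately have "\<bar>s - iphi\<bar> * (1/2) \<le> \<bar>x - iphi\<bar>" by (simp only:)
    hence "\<bar>s - iphi\<bar> \<le> 2 * \<bar>x - iphi\<bar>" by simp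
    hence "\<bar>(s - iphi) * y\<bar> \<le> 2 * \<bar>x - iphi\<bar>"
      using y mult_left_le[of y "\<bar>s - iphi\<bar>"] by (simp add: abs_mult)
    hence 1: "((s - iphi) * y)\<^sup>2 \<le> 4 * (x - iphi)\<^sup>2"
      using power_mono[of "\<bar>(s - iphi) * y\<bar>" "2 * \<bar>x - iphi\<bar>" 2] by (simp add: power_mult_distrib)
    have "(1 + iphi) * (y - iphi) = z - (s - iphi) * y"
      using iphi_square by (simp add: z_def power2_eq_square algebra_simps)
    hence "((1 + iphi) * (y - iphi))\<^sup>2 \<le> 2 * z\<^sup>2 + 2 * ((s - iphi) * y)\<^sup>2"
      using zero_le_power2[of "z + (s - iphi) * y"] by (simp add: power2_diff power2_sum)
    moreover have "1 * (y - iphi)\<^sup>2 \<le> (1 + iphi)\<^sup>2 * (y - iphi)\<^sup>2"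
      using iphi_bounds by (intro mult_right_mono) (auto intro: one_le_power)
    ultimately have "(y - iphi)\<^sup>2 \<le> 2 * z\<^sup>2 + 8 * (x - iphi)\<^sup>2"
      using 1 by (simp add: power_mult_distrib)
    moreover have "z\<^sup>2 \<ge> 0" by simp
    ultimately have "(x - iphi)\<^sup>2 + (y - iphi)\<^sup>2 \<le> 9 * ((x - iphi)\<^sup>2 + z\<^sup>2)"
      unfolding distrib_left by linarith
    thus ?thesis by simp
  qed
  finally show ?thesis .
qed

section \<open>Local behaviour at the maximum on the scale 1 / sqrt n\<close>

lemma second_order_limit:
  fixes f f' :: "real \<Rightarrow> real"
  assumes f: "\<forall>\<^sub>F x in nhds x0. (f has_real_derivative f' x) (at x)"
    and f'0: "f' x0 = 0" and A: "(f' has_real_derivative A) (at x0)"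
  shows "(\<lambda>x. (f x - f x0) / (x - x0)\<^sup>2) \<midarrow>x0\<rightarrow> A / 2"
\<comment> \<open>After one use of l'Hopital the remaining quotient is the difference quotient of
  \<open>f'\<close> at \<open>x0\<close>, so a second derivative is required at that single
  point.\<close>
proof (rule lhopital)
  have "(f has_real_derivative f' x0) (at x0)" using f by (rule eventually_nhds_x_imp_x)
  hence "isCont f x0" by (rule DERIV_isCont)
  thus "(\<lambda>x. f x - f x0) \<midarrow>x0\<rightarrow> 0" by (simp add: isCont_def LIM_zero)
  show "(\<lambda>x. (x - x0)\<^sup>2) \<midarrow>x0\<rightarrow> 0"
    by (rule tendsto_eq_intros refl | simp)+
  show "\<forall>\<^sub>F x in at x0. (x - x0)\<^sup>2 \<noteq> 0" "\<forall>\<^sub>F x in at x0. 2 * (x - x0) \<noteq> 0"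
    by (auto simp: eventually_at_filter)
  show "\<forall>\<^sub>F x in at x0. ((\<lambda>x. f x - f x0) has_real_derivative f' x) (at x)"
  proof -
    have "\<forall>\<^sub>F x in at x0. (f has_real_derivative f' x) (at x)"
      using f by (auto simp: eventually_at_filter elim: eventually_mono)
    thus ?thesis by eventually_elim (auto intro!: derivative_eq_intros)
  qed
  show "\<forall>\<^sub>F x in at x0. ((\<lambda>x. (x - x0)\<^sup>2) has_real_derivative 2 * (x - x0)) (at x)"
    by (intro always_eventually allI) (auto intro!: derivative_eq_intros)
  have "(\<lambda>x. (f' x - f' x0) / (x - x0)) \<midarrow>x0\<rightarrow> A"
    using A by (simp add: has_field_derivative_iff)
  from tendsto_divide[OF this tendsto_const[of 2]]
  show "((\<lambda>x. f' x / (2 * (x - x0))) \<longlongrightarrow> A / 2) (at x0)"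
    by (simp add: f'0 mult.commute)
qed

lemma div_sqrt_tendsto_0: "(\<lambda>n. a / sqrt (real n)) \<longlonglongrightarrow> 0"
  by real_asymp

lemma log_ridge_local:
  "(\<lambda>n. real n * (log_ridge (iphi + a / sqrt (real n)) - log_ridge iphi)) \<longlonglongrightarrow> - ((phi / 2 + 1) * phi ^ 3 / 2 * a\<^sup>2)"
proof (cases "a = 0")
  case False
  let ?D = "\<lambda>x. (sqrt (1 - x) - x) / (x * (1 - x))"
  have "\<forall>\<^sub>F x in nhds iphi. x \<in> {0<..<1}"
    using iphi_bounds by (intro eventually_nhds_in_open) auto
  hence ev: "\<forall>\<^sub>F x in nhds iphi. (log_ridge has_real_derivative ?D x) (at x)"
    by eventually_elim (rule log_ridge_has_derivative)
  \<comment> \<open>The numerator of \<open>?D\<close> vanishes at \<open>iphi\<close>, so the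
    quotient rule leaves its derivative - phi/2 - 1 over iphi (1 - iphi) = 1 / phi^3.\<close>
  have "(?D has_real_derivative ((- (inverse iphi / 2) - 1) * (iphi * (1 - iphi))
      - (iphi - iphi) * (1 - iphi - iphi)) / (iphi * (1 - iphi))\<^sup>2) (at iphi)"
    using iphi_bounds
    by (auto intro!: derivative_eq_intros simp: sqrt_one_minus_iphi power2_eq_square)
  also have "((- (inverse iphi / 2) - 1) * (iphi * (1 - iphi)) - (iphi - iphi) * (1 - iphi - iphi)) / (iphi * (1 - iphi))\<^sup>2
     = - ((phi / 2 + 1) * phi ^ 3)"
  proof -
    have "inverse iphi = phi" by (simp add: iphi_eq)
    moreover have "iphi * (1 - iphi) = 1 / phi ^ 3"
      by (simp flip: iphi_square) (simp add: iphi_eq power3_eq_cube power2_eq_square)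
    ultimately show ?thesis using phi_gt_1 by (simp only:) (simp add: power2_eq_square field_simps)
  qed
  finally have "(?D has_real_derivative - ((phi / 2 + 1) * phi ^ 3)) (at iphi)" .
  from second_order_limit[OF ev _ this]
  have lim: "(\<lambda>x. (log_ridge x - log_ridge iphi) / (x - iphi)\<^sup>2) \<midarrow>iphi\<rightarrow> - ((phi / 2 + 1) * phi ^ 3) / 2"
    by (simp add: sqrt_one_minus_iphi)
  have "(\<lambda>n. iphi + a / sqrt (real n)) \<longlonglongrightarrow> iphi + 0"
    by (intro tendsto_intros div_sqrt_tendsto_0)
  moreover have "eventually (\<lambda>n. iphi + a / sqrt (real n) \<noteq> iphi) sequentially"
    using eventually_gt_at_top[of 0] by eventually_elim (use False in auto)
  ultimately have "filterlim (\<lambda>n. iphi + a / sqrt (real n)) (at iphi) sequentially"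
    by (simp add: filterlim_at)
  from filterlim_compose[OF lim this]
  have "(\<lambda>n. (log_ridge (iphi + a / sqrt (real n)) - log_ridge iphi) / (a / sqrt (real n))\<^sup>2 * a\<^sup>2) \<longlonglongrightarrow> - ((phi / 2 + 1) * phi ^ 3) / 2 * a\<^sup>2"
    by (intro tendsto_mult tendsto_const) simp
  moreover have "eventually (\<lambda>n. (log_ridge (iphi + a / sqrt (real n)) - log_ridge iphi) / (a / sqrt (real n))\<^sup>2 * a\<^sup>2
     = real n * (log_ridge (iphi + a / sqrt (real n)) - log_ridge iphi)) sequentially"
    using eventually_gt_at_top[of 0] by eventually_elim (use False in \<open>simp add: power_divide\<close>)
  ultimately show ?thesis by (auto dest: Lim_transform_eventually)
qed auto

text \<open>A directional derivative: the function vanishes at the maximum and is followed along the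
  ray with direction (a, b) and parameter t = 1 / sqrt n.\<close>

lemma ridge_distance_local:
  "(\<lambda>n. sqrt (real n) * ((1 + sqrt (1 - (iphi + a / sqrt (real n)))) * (iphi + b / sqrt (real n)) - 1))
     \<longlonglongrightarrow> phi * b - a / 2"
proof -
  let ?f = "\<lambda>t. (1 + sqrt (1 - (iphi + t * a))) * (iphi + t * b) - 1"
  have f0: "?f 0 = 0"
    using iphi_square by (simp add: sqrt_one_minus_iphi power2_eq_square algebra_simps)
  have "(?f has_real_derivative (- a * (inverse iphi / 2)) * iphi + (1 + iphi) * b) (at 0)"
    using iphi_bounds by (auto intro!: derivative_eq_intros simp: sqrt_one_minus_iphi)
  also have "(- a * (inverse iphi / 2)) * iphi + (1 + iphi) * b = phi * b - a / 2"
    using iphi_bounds by (simp add: iphi_def)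
  finally have lim: "(\<lambda>t. ?f t / t) \<midarrow>0\<rightarrow> phi * b - a / 2"
    using f0 by (simp add: has_field_derivative_iff)
  have "filterlim (\<lambda>n. 1 / sqrt (real n)) (at 0) sequentially"
    using eventually_gt_at_top[of 0]
    by (auto simp: filterlim_at div_sqrt_tendsto_0 elim!: eventually_mono)
  from filterlim_compose[OF lim this] show ?thesis by (simp add: mult.commute)
qed

lemma ln_one_minus_limit:
  fixes w :: "nat \<Rightarrow> real"
  assumes lim: "(\<lambda>n. real n * w n) \<longlonglongrightarrow> l" and w: "\<forall>\<^sub>F n in sequentially. 0 \<le> w n \<and> w n < 1"
  shows "(\<lambda>n. real n * ln (1 - w n)) \<longlonglongrightarrow> - l"
proof -
  have "(\<lambda>n. real n * w n * (1 / real n)) \<longlonglongrightarrow> l * 0"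
    by (intro tendsto_mult lim lim_1_over_n)
  moreover have "eventually (\<lambda>n. real n * w n * (1 / real n) = w n) sequentially"
    using eventually_gt_at_top[of 0] by eventually_elim auto
  ultimately have w0: "w \<longlonglongrightarrow> 0" by (auto dest: Lim_transform_eventually)
  show ?thesis
  proof (rule tendsto_sandwich)
    have "(\<lambda>n. - (real n * w n) / (1 - w n)) \<longlonglongrightarrow> - l / (1 - 0)"
      by (intro tendsto_intros lim w0) auto
    thus "(\<lambda>n. - (real n * w n) / (1 - w n)) \<longlonglongrightarrow> - l" by simp
    show "(\<lambda>n. - (real n * w n)) \<longlonglongrightarrow> - l" by (intro tendsto_intros lim)
    show "\<forall>\<^sub>F n in sequentially. - (real n * w n) / (1 - w n) \<le> real n * ln (1 - w n)"
      using w
    proof eventually_elim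
      case (elim n)
      have "ln (1 / (1 - w n)) \<le> 1 / (1 - w n) - 1" using elim by (intro ln_le_minus_one) auto
      also have "\<dots> = w n / (1 - w n)" using elim by (simp add: field_simps)
      finally have "- (w n / (1 - w n)) \<le> ln (1 - w n)" using elim by (simp add: ln_div)
      from mult_left_mono[OF this, of "real n"] show ?case by simp
    qed
    show "\<forall>\<^sub>F n in sequentially. real n * ln (1 - w n) \<le> - (real n * w n)"
      using w
    proof eventually_elim
      case (elim n)
      have "ln (1 - w n) \<le> - w n" using elim ln_le_minus_one[of "1 - w n"] by simp
      from mult_left_mono[OF this, of "real n"] show ?case by simp
    qed
  qed
qed

text \<open>The exponent has one contribution along the ridge and one from the squared distance to
  it. The latter is divided by 1 - xy, which tends to 1 - iphi^2 = iphi, whence the factor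
  \<open>phi\<close>.\<close>

lemma apery_base_local:
  "(\<lambda>n. (phi ^ 5 * apery_base (iphi + a / sqrt (real n)) (iphi + b / sqrt (real n))) ^ n) \<longlonglongrightarrow>
     exp (- ((phi / 2 + 1) * phi ^ 3 / 2 * a\<^sup>2) - phi * (phi * b - a / 2)\<^sup>2)"
proof -
  define x where "x = (\<lambda>n. iphi + a / sqrt (real n))"
  define y where "y = (\<lambda>n. iphi + b / sqrt (real n))"
  define z where "z = (\<lambda>n. (1 + sqrt (1 - x n)) * y n - 1)"
  define w where "w = (\<lambda>n. (z n)\<^sup>2 / (1 - x n * y n))"
  have xl: "x \<longlonglongrightarrow> iphi" and yl: "y \<longlonglongrightarrow> iphi"
    unfolding x_def y_def using tendsto_add[OF tendsto_const[of iphi] div_sqrt_tendsto_0[of a]]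
      tendsto_add[OF tendsto_const[of iphi] div_sqrt_tendsto_0[of b]] by simp_all
  have xe: "\<forall>\<^sub>F n in sequentially. x n \<in> {0<..<1}" and ye: "\<forall>\<^sub>F n in sequentially. y n \<in> {0<..<1}"
    using iphi_bounds topological_tendstoD[OF xl, of "{0<..<1}"] topological_tendstoD[OF yl, of "{0<..<1}"] by auto
  have D: "(\<lambda>n. 1 - x n * y n) \<longlonglongrightarrow> 1 - iphi * iphi"
    by (intro tendsto_intros xl yl)
  have D0: "1 - iphi * iphi = iphi" using iphi_square by (simp add: power2_eq_square)
  have zl: "(\<lambda>n. sqrt (real n) * z n) \<longlonglongrightarrow> phi * b - a / 2"
    unfolding z_def x_def y_def by (rule ridge_distance_local)
  have "(\<lambda>n. (sqrt (real n) * z n)\<^sup>2 / (1 - x n * y n)) \<longlonglongrightarrow> (phi * b - a / 2)\<^sup>2 / iphi"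
    using iphi_bounds by (intro tendsto_divide tendsto_power zl) (use D D0 in auto)
  hence wl: "(\<lambda>n. real n * w n) \<longlonglongrightarrow> phi * (phi * b - a / 2)\<^sup>2"
    by (simp add: w_def power_mult_distrib iphi_eq mult.commute)
  have factored: "\<forall>\<^sub>F n in sequentially. apery_base (x n) (y n) = exp (log_ridge (x n)) * (1 - w n) \<and> 0 \<le> w n \<and> w n < 1"
    using xe ye
  proof eventually_elim
    case (elim n)
    have eq: "apery_base (x n) (y n) = exp (log_ridge (x n)) * (1 - w n)"
      unfolding w_def z_def by (rule apery_base_factor[OF elim])
    with apery_base_pos[OF elim] have "1 - w n > 0" by (simp add: zero_less_mult_iff)
    thus ?case using eq xy_less_1[OF elim] by (simp add: w_def)
  qed
  have "(\<lambda>n. real n * ln (1 - w n)) \<longlonglongrightarrow> - (phi * (phi * b - a / 2)\<^sup>2)"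
    by (rule ln_one_minus_limit[OF wl]) (use factored in \<open>auto elim: eventually_mono\<close>)
  hence "(\<lambda>n. exp (real n * (log_ridge (x n) - log_ridge iphi) + real n * ln (1 - w n))) \<longlonglongrightarrow>
      exp (- ((phi / 2 + 1) * phi ^ 3 / 2 * a\<^sup>2) + - (phi * (phi * b - a / 2)\<^sup>2))"
    using log_ridge_local[of a] unfolding x_def by (intro tendsto_exp tendsto_add)
  moreover have "\<forall>\<^sub>F n in sequentially. exp (real n * (log_ridge (x n) - log_ridge iphi) + real n * ln (1 - w n))
      = (phi ^ 5 * apery_base (x n) (y n)) ^ n"
    using factored
  proof eventually_elim
    case (elim n)
    have "phi ^ 5 * apery_base (x n) (y n) = exp (log_ridge (x n) - log_ridge iphi + ln (1 - w n))"
      using elim exp_log_ridge_iphi by (simp add: exp_add exp_diff)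
    hence "(phi ^ 5 * apery_base (x n) (y n)) ^ n = exp (real n * (log_ridge (x n) - log_ridge iphi + ln (1 - w n)))"
      by (simp add: exp_of_nat_mult)
    thus ?case by (simp add: algebra_simps)
  qed
  ultimately show ?thesis unfolding x_def y_def by (auto dest: Lim_transform_eventually)
qed

section \<open>Gaussian integrals and passage to the limit\<close>

lemma nn_integral_gaussian:
  fixes c m :: real
  assumes c: "c > 0"
  shows "(\<integral>\<^sup>+x. ennreal (exp (- c * (x - m)\<^sup>2)) \<partial>lborel) = ennreal (sqrt (pi / c))"
proof -
  define s where "s = 1 / sqrt (2 * c)"
  have s: "s > 0" "s\<^sup>2 = 1 / (2 * c)" using c by (simp_all add: s_def power_divide)
  have "exp (- c * (x - m)\<^sup>2) = sqrt (pi / c) * normal_density m s x" for x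
    using c by (simp add: normal_density_def s(2) real_sqrt_divide)
  hence "(\<integral>\<^sup>+x. ennreal (exp (- c * (x - m)\<^sup>2)) \<partial>lborel) = (\<integral>\<^sup>+x. ennreal (sqrt (pi / c)) * ennreal (normal_density m s x) \<partial>lborel)"
    using c by (simp add: ennreal_mult)
  also have "\<dots> = ennreal (sqrt (pi / c)) * (\<integral>\<^sup>+x. ennreal (normal_density m s x) \<partial>lborel)"
    by (rule nn_integral_cmult) simp
  also have "(\<integral>\<^sup>+x. ennreal (normal_density m s x) \<partial>lborel) = 1"
    using s by (subst nn_integral_eq_integral) (auto simp: integrable_normal_density integral_normal_density)
  finally show ?thesis by simp
qed

lemma nn_integral_lborel_pair_affine:
  fixes f :: "real \<times> real \<Rightarrow> ennreal" and c t :: real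
  assumes [measurable]: "f \<in> borel_measurable (lborel \<Otimes>\<^sub>M lborel)" and c: "c > 0"
  shows "(\<integral>\<^sup>+p. f p \<partial>(lborel \<Otimes>\<^sub>M lborel)) =
     ennreal (c * c) * (\<integral>\<^sup>+p. f (t + c * fst p, t + c * snd p) \<partial>(lborel \<Otimes>\<^sub>M lborel))"
proof -
  have "(\<integral>\<^sup>+p. f p \<partial>(lborel \<Otimes>\<^sub>M lborel)) = (\<integral>\<^sup>+x. \<integral>\<^sup>+y. f (x, y) \<partial>lborel \<partial>lborel)"
    by (rule lborel.nn_integral_fst[symmetric]) measurable
  also have "\<dots> = (\<integral>\<^sup>+x. ennreal c * (\<integral>\<^sup>+y. f (x, t + c * y) \<partial>lborel) \<partial>lborel)"
    using c by (intro nn_integral_cong) (subst nn_integral_real_affine[where c = c and t = t], auto)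
  also have "\<dots> = ennreal c * (\<integral>\<^sup>+x. \<integral>\<^sup>+y. f (x, t + c * y) \<partial>lborel \<partial>lborel)"
    by (intro nn_integral_cmult) measurable
  also have "(\<integral>\<^sup>+x. \<integral>\<^sup>+y. f (x, t + c * y) \<partial>lborel \<partial>lborel) =
      ennreal c * (\<integral>\<^sup>+x. \<integral>\<^sup>+y. f (t + c * x, t + c * y) \<partial>lborel \<partial>lborel)"
    using c by (subst nn_integral_real_affine[where c = c and t = t]) auto
  also have "(\<integral>\<^sup>+x. \<integral>\<^sup>+y. f (t + c * x, t + c * y) \<partial>lborel \<partial>lborel) =
      (\<integral>\<^sup>+p. f (t + c * fst p, t + c * snd p) \<partial>(lborel \<Otimes>\<^sub>M lborel))"
    by (subst lborel.nn_integral_fst[symmetric]) auto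
  finally show ?thesis using c by (simp add: ennreal_mult mult.assoc)
qed

text \<open>
  The integrand of \<open>apery_F (n - 1/2)\<close>, multiplied by \<open>phi ^ (5 * n)\<close> and zoomed in at the scale \<open>1 / sqrt n\<close>
  around the maximum \<open>(iphi, iphi)\<close> of \<open>apery_base\<close>.
\<close>

definition rescaled :: "nat \<Rightarrow> real \<times> real \<Rightarrow> ennreal" where
  "rescaled n = (\<lambda>(a, b). let x = iphi + a / sqrt (real n); y = iphi + b / sqrt (real n) in
     ennreal ((phi ^ 5 * apery_base x y) ^ n * (1 / sqrt (apery_base x y) / (1 - x * y))) * (indicator {0<..<1} x * indicator {0<..<1} y))"

lemma rescaled_measurable [measurable]: "rescaled n \<in> borel_measurable (lborel \<Otimes>\<^sub>M lborel)"
  unfolding rescaled_def Let_def apery_base_def by measurable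

text \<open>The substitution in two variables has Jacobian 1/n, which cancels the factor
  \<open>real n\<close>; the exponent n - 1/2 accounts for the quotient by
  \<open>sqrt (apery_base x y)\<close> in \<open>rescaled\<close>.\<close>

lemma apery_F_eq_rescaled:
  assumes n: "n > 0"
  shows "ennreal (real n * phi ^ (5 * n) * apery_F (real n - 1/2)) = (\<integral>\<^sup>+p. rescaled n p \<partial>(lborel \<Otimes>\<^sub>M lborel))"
proof -
  define v where "v = real n - 1/2"
  define K where "K = euler_kernel (v + 1) (v + 1) (v + 1) (v + 1) (v + 1)"
  define c where "c = 1 / sqrt (real n)"
  have c: "c > 0" "c * c = 1 / real n" using n by (simp_all add: c_def)
  have [measurable]: "K \<in> borel_measurable (lborel \<Otimes>\<^sub>M lborel)"
    unfolding K_def euler_kernel_def by measurable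
  have v: "v > -1" using n by (simp add: v_def)
  have K_eq: "ennreal (phi ^ (5 * n)) * K (iphi + c * fst p, iphi + c * snd p) = rescaled n p" for p
  proof -
    obtain a b where p: "p = (a, b)" by force
    define x where "x = iphi + a / sqrt (real n)"
    define y where "y = iphi + b / sqrt (real n)"
    have xy: "iphi + c * a = x" "iphi + c * b = y" by (simp_all add: x_def y_def c_def)
    have "ennreal (phi ^ (5 * n)) * K (x, y) =
       ennreal ((phi ^ 5 * apery_base x y) ^ n * (1 / sqrt (apery_base x y) / (1 - x * y))) * (indicator {0<..<1} x * indicator {0<..<1} y)"
    proof (cases "x \<in> {0<..<1} \<and> y \<in> {0<..<1}")
      case False
      thus ?thesis by (auto simp: K_def euler_kernel_def)
    next
      case True
      have D: "1 - x * y > 0" using xy_less_1[of x y] True by auto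
      have gp: "apery_base x y > 0" using apery_base_pos True by auto
      have "x powr v * (1 - x) powr v * (y powr v * (1 - y) powr v) * (1 - x * y) powr (- v - 1)
         = apery_base x y powr v / (1 - x * y)"
        using True D by (simp add: apery_base_def powr_mult powr_divide powr_diff powr_minus divide_simps)
      also have "apery_base x y powr v = apery_base x y ^ n / sqrt (apery_base x y)"
        using gp by (simp add: v_def powr_diff powr_realpow powr_half_sqrt)
      finally show ?thesis using True gp phi_gt_1
        by (simp add: K_def euler_kernel_def ennreal_mult'[symmetric] power_mult power_mult_distrib mult.assoc)
    qed
    thus ?thesis unfolding p rescaled_def Let_def x_def y_def by (simp add: c_def)
  qed
  have Fnn: "apery_F v \<ge> 0" using apery_F_pos[OF v] by simp
  have "ennreal (apery_F v) = (\<integral>\<^sup>+p. K p \<partial>(lborel \<Otimes>\<^sub>M lborel))"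
    unfolding K_def by (rule apery_F_integral[OF v, symmetric])
  also have "\<dots> = ennreal (c * c) * (\<integral>\<^sup>+p. K (iphi + c * fst p, iphi + c * snd p) \<partial>(lborel \<Otimes>\<^sub>M lborel))"
    by (rule nn_integral_lborel_pair_affine) (use c in auto)
  finally have "ennreal (real n * phi ^ (5 * n)) * ennreal (apery_F v) =
     ennreal (real n * phi ^ (5 * n)) * (ennreal (c * c) * (\<integral>\<^sup>+p. K (iphi + c * fst p, iphi + c * snd p) \<partial>(lborel \<Otimes>\<^sub>M lborel)))"
    by simp
  also have "\<dots> = ennreal (real n * phi ^ (5 * n) * (c * c)) * (\<integral>\<^sup>+p. K (iphi + c * fst p, iphi + c * snd p) \<partial>(lborel \<Otimes>\<^sub>M lborel))"
  proof -
    have "ennreal (real n * phi ^ (5 * n) * (c * c)) = ennreal (real n * phi ^ (5 * n)) * ennreal (c * c)"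
      using phi_gt_1 c by (intro ennreal_mult) auto
    thus ?thesis by (simp only: mult.assoc)
  qed
  also have "real n * phi ^ (5 * n) * (c * c) = phi ^ (5 * n)" using n c by simp
  also have "ennreal (phi ^ (5 * n)) * (\<integral>\<^sup>+p. K (iphi + c * fst p, iphi + c * snd p) \<partial>(lborel \<Otimes>\<^sub>M lborel))
     = (\<integral>\<^sup>+p. ennreal (phi ^ (5 * n)) * K (iphi + c * fst p, iphi + c * snd p) \<partial>(lborel \<Otimes>\<^sub>M lborel))"
    by (rule nn_integral_cmult[symmetric]) measurable
  finally show ?thesis using Fnn phi_gt_1 by (simp add: K_eq ennreal_mult' v_def)
qed

lemma rescaled_le_gaussian:
  assumes n: "n \<ge> 3"
  shows "rescaled n (a, b) \<le> ennreal (phi ^ 10 * exp (- (1/27) * a\<^sup>2) * exp (- (1/27) * b\<^sup>2))"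
proof -
  define x where "x = iphi + a / sqrt (real n)"
  define y where "y = iphi + b / sqrt (real n)"
  show ?thesis
  proof (cases "x \<in> {0<..<1} \<and> y \<in> {0<..<1}")
    case False
    thus ?thesis by (auto simp: rescaled_def Let_def x_def[symmetric] y_def[symmetric])
  next
    case True
    define q where "q = apery_base x y"
    have D: "1 - x * y > 0" using xy_less_1[of x y] True by auto
    have q: "q > 0" unfolding q_def using apery_base_pos True by auto
    have xD: "1 - x \<le> 1 - x * y" "1 - y \<le> 1 - x * y"
      using True mult_left_le[of y x] mult_left_le[of x y] by (auto simp: mult.commute)
    have "x * (1 - x) * (y * (1 - y)) \<le> 1 * (1 - x * y) * (1 * (1 - x * y))"
      using True xD D by (intro mult_mono) auto
    hence qD: "q / (1 - x * y) \<le> 1"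
      using D by (simp add: q_def apery_base_def divide_le_eq)
    moreover have "q \<le> q / (1 - x * y)"
      using q D True by (simp add: pos_le_divide_eq mult_left_le)
    ultimately have q1: "q \<le> 1" by simp
    \<comment> \<open>Two of the n powers are set aside to absorb the singular factor: q^2 / sqrt q
      / (1 - xy) = sqrt q * (q / (1 - xy)) \<le> 1. The remaining n - 2 \<ge> n/3 powers weaken the
      Gaussian constant from 1/9 to 1/27.\<close>
    define m where "m = n - 2"
    have nm: "n = m + 2" using n by (simp add: m_def)
    define E where "E = ((x - iphi)\<^sup>2 + (y - iphi)\<^sup>2) / 9"
    have "real n * E = (a\<^sup>2 + b\<^sup>2) / 9"
      using n by (simp add: E_def x_def y_def power_divide flip: add_divide_distrib)
    moreover have "real n * E \<le> 3 * (real m * E)"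
      using mult_right_mono[of "real n" "3 * real m" E] n by (simp add: nm E_def)
    ultimately have mE: "(a\<^sup>2 + b\<^sup>2) / 27 \<le> real m * E" by simp
    have "(phi ^ 5 * q) ^ m \<le> exp (- E) ^ m"
      using apery_base_le_gaussian[of x y] True q phi_gt_1 unfolding q_def E_def
      by (intro power_mono) (auto simp: minus_divide_left)
    also have "\<dots> = exp (- (real m * E))" by (simp flip: exp_of_nat_mult)
    also have "\<dots> \<le> exp (- ((a\<^sup>2 + b\<^sup>2) / 27))" using mE by simp
    finally have 1: "(phi ^ 5 * q) ^ m \<le> exp (- ((a\<^sup>2 + b\<^sup>2) / 27))" .
    have "(phi ^ 5 * q)\<^sup>2 * (1 / sqrt q / (1 - x * y)) = phi ^ 10 * (sqrt q * (q / (1 - x * y)))"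
    proof -
      have "q\<^sup>2 / sqrt q = sqrt q * q"
        using q by (simp add: field_simps power2_eq_square)
      moreover have "(phi ^ 5 * q)\<^sup>2 * (1 / sqrt q / (1 - x * y)) = phi ^ 10 * ((q\<^sup>2 / sqrt q) / (1 - x * y))"
        by (simp add: power_mult_distrib flip: power_mult)
      ultimately show ?thesis by simp
    qed
    also have "\<dots> \<le> phi ^ 10 * (1 * 1)"
      using q1 qD q D phi_gt_1 by (intro mult_mono) auto
    finally have 2: "(phi ^ 5 * q)\<^sup>2 * (1 / sqrt q / (1 - x * y)) \<le> phi ^ 10" by simp
    have "(phi ^ 5 * q) ^ n * (1 / sqrt q / (1 - x * y)) =
        (phi ^ 5 * q) ^ m * ((phi ^ 5 * q)\<^sup>2 * (1 / sqrt q / (1 - x * y)))"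
      unfolding nm power_add by (simp only: mult.assoc)
    also have "\<dots> \<le> exp (- ((a\<^sup>2 + b\<^sup>2) / 27)) * phi ^ 10"
      using 1 2 q D by (intro mult_mono) auto
    also have "exp (- ((a\<^sup>2 + b\<^sup>2) / 27)) = exp (- (1/27) * a\<^sup>2) * exp (- (1/27) * b\<^sup>2)"
      by (simp add: exp_add[symmetric] add_divide_distrib)
    finally show ?thesis using True
      by (simp add: rescaled_def Let_def x_def[symmetric] y_def[symmetric] q_def ennreal_leI mult_ac)
  qed
qed

lemma rescaled_tendsto:
  "(\<lambda>n. rescaled n (a, b)) \<longlonglongrightarrow>
     ennreal (sqrt (phi ^ 7) * exp (- ((phi / 2 + 1) * phi ^ 3 / 2) * a\<^sup>2) * exp (- (phi ^ 3) * (b - a / (2 * phi))\<^sup>2))"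
proof -
  define x where "x = (\<lambda>n. iphi + a / sqrt (real n))"
  define y where "y = (\<lambda>n. iphi + b / sqrt (real n))"
  have xl: "x \<longlonglongrightarrow> iphi" and yl: "y \<longlonglongrightarrow> iphi"
    unfolding x_def y_def using tendsto_add[OF tendsto_const[of iphi] div_sqrt_tendsto_0[of a]]
      tendsto_add[OF tendsto_const[of iphi] div_sqrt_tendsto_0[of b]] by simp_all
  have xe: "\<forall>\<^sub>F n in sequentially. x n \<in> {0<..<1}" and ye: "\<forall>\<^sub>F n in sequentially. y n \<in> {0<..<1}"
    using iphi_bounds topological_tendstoD[OF xl, of "{0<..<1}"] topological_tendstoD[OF yl, of "{0<..<1}"] by auto
  have D0: "1 - iphi * iphi = iphi" using iphi_square by (simp add: power2_eq_square)
  have "(\<lambda>n. apery_base (x n) (y n)) \<longlonglongrightarrow> iphi * (1 - iphi) * (iphi * (1 - iphi)) / (1 - iphi * iphi)"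
    unfolding apery_base_def using D0 iphi_bounds by (intro tendsto_intros xl yl) auto
  also have "iphi * (1 - iphi) * (iphi * (1 - iphi)) / (1 - iphi * iphi) = 1 / phi ^ 5"
    unfolding D0 iphi_square[symmetric] using phi_gt_1 by (simp add: iphi_eq power2_eq_square eval_nat_numeral)
  finally have gl: "(\<lambda>n. apery_base (x n) (y n)) \<longlonglongrightarrow> 1 / phi ^ 5" .
  have "(\<lambda>n. 1 / sqrt (apery_base (x n) (y n)) / (1 - x n * y n)) \<longlonglongrightarrow> 1 / sqrt (1 / phi ^ 5) / (1 - iphi * iphi)"
    using D0 iphi_bounds phi_gt_1 by (intro tendsto_intros gl xl yl) auto
  also have "1 / sqrt (1 / phi ^ 5) / (1 - iphi * iphi) = sqrt (phi ^ 7)"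
  proof -
    have "phi ^ 7 = phi ^ 5 * phi\<^sup>2" by (simp flip: power_add)
    hence "sqrt (phi ^ 7) = sqrt (phi ^ 5) * phi" using phi_gt_1 by (simp only: real_sqrt_mult) simp
    thus ?thesis unfolding D0 using phi_gt_1 by (simp add: iphi_eq real_sqrt_divide)
  qed
  finally have hl: "(\<lambda>n. 1 / sqrt (apery_base (x n) (y n)) / (1 - x n * y n)) \<longlonglongrightarrow> sqrt (phi ^ 7)" .
  have "(\<lambda>n. ennreal ((phi ^ 5 * apery_base (x n) (y n)) ^ n * (1 / sqrt (apery_base (x n) (y n)) / (1 - x n * y n)))) \<longlonglongrightarrow>
      ennreal (exp (- ((phi / 2 + 1) * phi ^ 3 / 2 * a\<^sup>2) - phi * (phi * b - a / 2)\<^sup>2) * sqrt (phi ^ 7))"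
    by (intro tendsto_ennrealI tendsto_mult hl) (unfold x_def y_def, rule apery_base_local)
  moreover have "\<forall>\<^sub>F n in sequentially. ennreal ((phi ^ 5 * apery_base (x n) (y n)) ^ n * (1 / sqrt (apery_base (x n) (y n)) / (1 - x n * y n)))
      = rescaled n (a, b)"
    using xe ye by eventually_elim (simp add: rescaled_def Let_def x_def y_def)
  ultimately have "(\<lambda>n. rescaled n (a, b)) \<longlonglongrightarrow>
      ennreal (exp (- ((phi / 2 + 1) * phi ^ 3 / 2 * a\<^sup>2) - phi * (phi * b - a / 2)\<^sup>2) * sqrt (phi ^ 7))"
    by (rule Lim_transform_eventually)
  \<comment> \<open>In this form the integral over b is that of a shifted Gaussian and does not
    depend on a.\<close>
  also have "phi * (phi * b - a / 2)\<^sup>2 = phi ^ 3 * (b - a / (2 * phi))\<^sup>2"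
  proof -
    have "phi * b - a / 2 = phi * (b - a / (2 * phi))" using phi_gt_1 by (simp add: field_simps)
    thus ?thesis by (simp add: power_mult_distrib power2_eq_square power3_eq_cube)
  qed
  also have "exp (- (c * A) - z) * K = K * exp (- c * A) * exp (- z)" for c A z K :: real
    by (simp add: exp_diff exp_minus divide_inverse)
  finally show ?thesis by simp
qed

lemma phi_plus_2: "phi + 2 = sqrt 5 * phi"
  by (simp add: phi_def algebra_simps)

text \<open>By phi + 2 = sqrt 5 * phi, the coefficient of a^2 is sqrt 5 * phi^4 / 4; together with
  phi^3 from the other variable this cancels phi^7, and no power of phi survives.\<close>

lemma nn_integral_limit_gaussian:
  "(\<integral>\<^sup>+p. (case p of (a, b) \<Rightarrow> ennreal (sqrt (phi ^ 7) * exp (- ((phi / 2 + 1) * phi ^ 3 / 2) * a\<^sup>2) *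
      exp (- (phi ^ 3) * (b - a / (2 * phi))\<^sup>2))) \<partial>(lborel \<Otimes>\<^sub>M lborel)) = ennreal (2 * pi / sqrt (sqrt 5))"
  (is "?I = _")
proof -
  define c where "c = (phi / 2 + 1) * phi ^ 3 / 2"
  have c: "c > 0" using phi_gt_1 by (simp add: c_def)
  have "?I = (\<integral>\<^sup>+a. \<integral>\<^sup>+b. ennreal (sqrt (phi ^ 7) * exp (- c * a\<^sup>2)) *
     ennreal (exp (- (phi ^ 3) * (b - a / (2 * phi))\<^sup>2)) \<partial>lborel \<partial>lborel)"
    using phi_gt_1 by (subst lborel.nn_integral_fst[symmetric]) (auto simp: c_def ennreal_mult)
  also have "\<dots> = (\<integral>\<^sup>+a. ennreal (sqrt (phi ^ 7)) * ennreal (exp (- c * (a - 0)\<^sup>2)) * ennreal (sqrt (pi / phi ^ 3)) \<partial>lborel)"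
  proof (rule nn_integral_cong)
    fix a :: real
    have "(\<integral>\<^sup>+b. ennreal (exp (- (phi ^ 3) * (b - a / (2 * phi))\<^sup>2)) \<partial>lborel) = ennreal (sqrt (pi / phi ^ 3))"
      using phi_gt_1 by (intro nn_integral_gaussian) auto
    thus "(\<integral>\<^sup>+b. ennreal (sqrt (phi ^ 7) * exp (- c * a\<^sup>2)) * ennreal (exp (- (phi ^ 3) * (b - a / (2 * phi))\<^sup>2)) \<partial>lborel)
        = ennreal (sqrt (phi ^ 7)) * ennreal (exp (- c * (a - 0)\<^sup>2)) * ennreal (sqrt (pi / phi ^ 3))"
      using phi_gt_1 by (subst nn_integral_cmult) (auto simp: ennreal_mult)
  qed
  also have "\<dots> = ennreal (sqrt (phi ^ 7)) * ennreal (sqrt (pi / c)) * ennreal (sqrt (pi / phi ^ 3))"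
    using nn_integral_gaussian[OF c, of 0] by (simp add: nn_integral_cmult nn_integral_multc)
  also have "\<dots> = ennreal (sqrt (phi ^ 7 * (pi / c) * (pi / phi ^ 3)))"
    using c phi_gt_1 by (simp only: real_sqrt_mult ennreal_mult real_sqrt_ge_zero zero_le_power zero_le_mult_iff
      divide_nonneg_pos pi_ge_zero) (simp add: ennreal_mult)
  also have "phi ^ 7 * (pi / c) * (pi / phi ^ 3) = 4 * pi\<^sup>2 / sqrt 5"
  proof -
    have "c = (phi + 2) * phi ^ 3 / 4" by (simp add: c_def field_simps)
    also have "\<dots> = sqrt 5 * phi ^ 4 / 4" by (simp add: phi_plus_2 eval_nat_numeral)
    finally have c_eq: "c = sqrt 5 * phi ^ 4 / 4" .
    show ?thesis unfolding c_eq using phi_gt_1 by (simp add: field_simps eval_nat_numeral)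
  qed
  also have "sqrt (4 * pi\<^sup>2 / sqrt 5) = 2 * pi / sqrt (sqrt 5)"
    by (simp add: real_sqrt_mult real_sqrt_divide)
  finally show ?thesis .
qed

theorem apery_F_half_integer_asymp:
  "(\<lambda>n. real n * phi ^ (5 * n) * apery_F (real n - 1/2)) \<longlonglongrightarrow> 2 * pi / sqrt (sqrt 5)"
proof -
  let ?M = "lborel \<Otimes>\<^sub>M lborel :: (real \<times> real) measure"
  let ?lim = "\<lambda>(a, b). ennreal (sqrt (phi ^ 7) * exp (- ((phi / 2 + 1) * phi ^ 3 / 2) * a\<^sup>2) *
      exp (- (phi ^ 3) * (b - a / (2 * phi))\<^sup>2))"
  let ?w = "\<lambda>(a, b). ennreal (phi ^ 10 * exp (- (1/27) * a\<^sup>2) * exp (- (1/27) * b\<^sup>2))"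
  have "(\<lambda>n. \<integral>\<^sup>+p. rescaled (n + 3) p \<partial>?M) \<longlonglongrightarrow> (\<integral>\<^sup>+p. ?lim p \<partial>?M)"
  proof (rule nn_integral_dominated_convergence[where w = ?w])
    show "?lim \<in> borel_measurable ?M" "?w \<in> borel_measurable ?M" by measurable
    show "AE p in ?M. rescaled (n + 3) p \<le> ?w p" for n
    proof (rule AE_I2)
      fix p :: "real \<times> real"
      show "rescaled (n + 3) p \<le> ?w p"
        by (cases p) (simp only: prod.case, rule rescaled_le_gaussian, simp)
    qed
    show "AE p in ?M. (\<lambda>n. rescaled (n + 3) p) \<longlonglongrightarrow> ?lim p"
    proof (rule AE_I2)
      fix p :: "real \<times> real"
      show "(\<lambda>n. rescaled (n + 3) p) \<longlonglongrightarrow> ?lim p"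
        by (cases p) (simp only: prod.case, rule LIMSEQ_ignore_initial_segment[OF rescaled_tendsto])
    qed
    have "(\<integral>\<^sup>+p. ?w p \<partial>?M) = (\<integral>\<^sup>+a. \<integral>\<^sup>+b. ennreal (phi ^ 10) * ennreal (exp (- (1/27) * (a - 0)\<^sup>2)) *
        ennreal (exp (- (1/27) * (b - 0)\<^sup>2)) \<partial>lborel \<partial>lborel)"
      using phi_gt_1 by (subst lborel.nn_integral_fst[symmetric]) (auto simp: ennreal_mult)
    also have "\<dots> = ennreal (phi ^ 10) * ennreal (sqrt (pi / (1/27))) * ennreal (sqrt (pi / (1/27)))"
      using nn_integral_gaussian[of "1/27" 0] by (simp add: nn_integral_cmult nn_integral_multc)
    also have "\<dots> < \<infinity>" by (simp add: ennreal_mult_less_top)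
    finally show "(\<integral>\<^sup>+p. ?w p \<partial>?M) < \<infinity>" .
  qed measurable
  hence "(\<lambda>n. ennreal (real (n + 3) * phi ^ (5 * (n + 3)) * apery_F (real (n + 3) - 1/2))) \<longlonglongrightarrow> ennreal (2 * pi / sqrt (sqrt 5))"
    unfolding nn_integral_limit_gaussian by (subst apery_F_eq_rescaled) auto
  hence "(\<lambda>n. real (n + 3) * phi ^ (5 * (n + 3)) * apery_F (real (n + 3) - 1/2)) \<longlonglongrightarrow> 2 * pi / sqrt (sqrt 5)"
  proof (subst (asm) tendsto_ennreal_iff)
    have "0 \<le> apery_F (real (n + 3) - 1/2)" for n by (rule less_imp_le[OF apery_F_pos]) simp
    thus "\<forall>\<^sub>F n in sequentially. 0 \<le> real (n + 3) * phi ^ (5 * (n + 3)) * apery_F (real (n + 3) - 1/2)"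
      using phi_gt_1 by (intro always_eventually allI mult_nonneg_nonneg) auto
  qed auto
  thus ?thesis by (rule LIMSEQ_offset)
qed


section \<open>The continued fraction\<close>

text \<open>Euler's continuant with partial numerators, on the entries a(m), ..., a(m + n). It is
  expanded from the left because \<open>cf_tail\<close> unfolds from the left.\<close>

fun continuant :: "(nat \<Rightarrow> real) \<Rightarrow> (nat \<Rightarrow> real) \<Rightarrow> nat \<Rightarrow> nat \<Rightarrow> real" where
  "continuant a b m 0 = a m"
| "continuant a b m (Suc 0) = a m * a (Suc m) + b m"
| "continuant a b m (Suc (Suc n)) = a m * continuant a b (Suc m) (Suc n) + b m * continuant a b (Suc (Suc m)) n"

text \<open>Expansion from the right end, which yields the classical recurrence of the convergents.
  Expanding from the left exposes two shorter continuants that end at the same place, so the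
  induction must range over all starting points m.\<close>

lemma continuant_right_recurrence:
  "continuant a b m (Suc (Suc n)) = a (m + n + 2) * continuant a b m (Suc n) + b (m + n + 1) * continuant a b m n"
proof (induction n arbitrary: m rule: less_induct)
  case (less n)
  consider "n = 0" | "n = 1" | k where "n = Suc (Suc k)"
    by (metis One_nat_def not0_implies_Suc)
  thus ?case
  proof cases
    case 1
    thus ?thesis by (simp add: algebra_simps)
  next
    case 2
    thus ?thesis by (simp add: algebra_simps eval_nat_numeral)
  next
    case 3
    have 1: "continuant a b (Suc m) (Suc (Suc (Suc k))) = a (m + n + 2) * continuant a b (Suc m) (Suc (Suc k)) + b (m + n + 1) * continuant a b (Suc m) (Suc k)"
      using less.IH[of "Suc k" "Suc m"] 3 by (simp del: continuant.simps)
    have 2: "continuant a b (Suc (Suc m)) (Suc (Suc k)) = a (m + n + 2) * continuant a b (Suc (Suc m)) (Suc k) + b (m + n + 1) * continuant a b (Suc (Suc m)) k"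
      using less.IH[of k "Suc (Suc m)"] 3 by (simp del: continuant.simps)
    have "continuant a b m (Suc (Suc n)) = a m * continuant a b (Suc m) (Suc (Suc (Suc k))) + b m * continuant a b (Suc (Suc m)) (Suc (Suc k))"
      unfolding 3 by (rule continuant.simps)
    also have "\<dots> = a (m + n + 2) * (a m * continuant a b (Suc m) (Suc (Suc k)) + b m * continuant a b (Suc (Suc m)) (Suc k))
        + b (m + n + 1) * (a m * continuant a b (Suc m) (Suc k) + b m * continuant a b (Suc (Suc m)) k)"
      unfolding 1 2 by (simp add: algebra_simps)
    also have "a m * continuant a b (Suc m) (Suc (Suc k)) + b m * continuant a b (Suc (Suc m)) (Suc k) = continuant a b m (Suc n)"
      unfolding 3 by (rule continuant.simps[symmetric])
    also have "a m * continuant a b (Suc m) (Suc k) + b m * continuant a b (Suc (Suc m)) k = continuant a b m n"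
      unfolding 3 by (rule continuant.simps[symmetric])
    finally show ?thesis .
  qed
qed

lemma continuant_pos:
  assumes "\<And>k. k \<ge> m \<Longrightarrow> a k > 0" "\<And>k. k \<ge> m \<Longrightarrow> b k > 0"
  shows "continuant a b m n > 0"
  using assms by (induction a b m n rule: continuant.induct) (auto intro!: add_pos_pos mult_pos_pos)

lemma cf_tail_eq_continuant:
  assumes "\<And>k. k > m \<Longrightarrow> a k > 0" "\<And>k. k > m \<Longrightarrow> b k > 0"
  shows "cf_tail a b m (Suc n) = continuant a b m (Suc n) / continuant a b (Suc m) n"
  using assms
proof (induction n arbitrary: m)
  case 0
  have "a (Suc m) > 0" using 0 by simp
  thus ?case by (simp add: field_simps)
next
  case (Suc n)
  have pos: "continuant a b (Suc m) (Suc n) > 0" "continuant a b (Suc (Suc m)) n > 0"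
    using Suc.prems by (auto intro!: continuant_pos simp del: continuant.simps)
  have "cf_tail a b (Suc m) (Suc n) = continuant a b (Suc m) (Suc n) / continuant a b (Suc (Suc m)) n"
    using Suc.prems by (intro Suc.IH) auto
  hence "cf_tail a b m (Suc (Suc n)) = a m + b m / (continuant a b (Suc m) (Suc n) / continuant a b (Suc (Suc m)) n)"
    by (simp only: cf_tail.simps(2)[of a b m "Suc n"])
  also have "\<dots> = (a m * continuant a b (Suc m) (Suc n) + b m * continuant a b (Suc (Suc m)) n) / continuant a b (Suc m) (Suc n)"
    using pos by (simp add: add_divide_distrib del: continuant.simps)
  finally show ?case by (simp only: continuant.simps(3))
qed

definition cf_num :: "nat \<Rightarrow> real" where "cf_num n = continuant cfA cfB 0 n"

text \<open>Entries 1 to n form a continuant of index n - 1; for n = 0 the empty continuant 1 has to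
  be supplied separately.\<close>

definition cf_den :: "nat \<Rightarrow> real" where "cf_den n = (case n of 0 \<Rightarrow> 1 | Suc k \<Rightarrow> continuant cfA cfB 1 k)"

lemma cfA_pos: "cfA n > 0"
  by (simp add: cfA_def add_pos_pos add_nonneg_pos)

lemma cfB_pos: "n > 0 \<Longrightarrow> cfB n > 0"
  by (simp add: cfB_def)

lemma cf_den_pos: "cf_den n > 0"
  by (auto simp: cf_den_def cfA_pos cfB_pos split: nat.split intro!: continuant_pos)

lemma cf_convergent_eq: "cf_convergent cfA cfB n = cf_num n / cf_den n"
proof (cases n)
  case (Suc k)
  have "cf_tail cfA cfB 0 (Suc k) = continuant cfA cfB 0 (Suc k) / continuant cfA cfB (Suc 0) k"
    by (rule cf_tail_eq_continuant) (auto simp: cfA_pos cfB_pos)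
  thus ?thesis by (simp add: Suc cf_convergent_def cf_num_def cf_den_def del: cf_tail.simps continuant.simps)
qed (simp add: cf_convergent_def cf_num_def cf_den_def)

lemma cf_num_den_init: "cf_num 0 = 80" "cf_num 1 = 3600" "cf_den 0 = 1" "cf_den 1 = 47"
  by (simp_all add: cf_num_def cf_den_def cfA_def cfB_def)

lemma cf_num_recurrence: "cf_num (n + 2) = cfA (n + 2) * cf_num (n + 1) + cfB (n + 1) * cf_num n"
  using continuant_right_recurrence[of cfA cfB 0 n] by (simp add: cf_num_def del: continuant.simps)

lemma cf_den_recurrence: "cf_den (n + 2) = cfA (n + 2) * cf_den (n + 1) + cfB (n + 1) * cf_den n"
proof (cases n)
  case 0
  thus ?thesis by (simp add: cf_den_def eval_nat_numeral)
next
  case (Suc k)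
  thus ?thesis using continuant_right_recurrence[of cfA cfB 1 k] by (simp add: cf_den_def del: continuant.simps)
qed

section \<open>The remainder of the continued fraction\<close>

definition apery_half :: "nat \<Rightarrow> real" where "apery_half n = apery_F (real n - 1/2)"

lemma apery_half_pos: "apery_half n > 0"
  unfolding apery_half_def by (rule apery_F_pos) simp

text \<open>With v = n + 1/2, completing the square turns 4 (11 v^2 + 11 v + 3) into 44 (n + 1)^2 +
  1, the generic partial denominator.\<close>

lemma apery_half_recurrence: "(2 * real n + 3)\<^sup>2 * apery_half (n + 2) + (44 * (real n + 1)\<^sup>2 + 1) * apery_half (n + 1) = (2 * real n + 1)\<^sup>2 * apery_half n"
proof -
  define v where "v = real n + 1/2"
  have "(v + 1)\<^sup>2 * apery_F (v + 1) + (11 * v\<^sup>2 + 11 * v + 3) * apery_F v = v\<^sup>2 * apery_F (v - 1)"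
    by (rule apery_F_recurrence) (simp add: v_def)
  moreover have "apery_F (v + 1) = apery_half (n + 2)" "apery_F v = apery_half (n + 1)" "apery_F (v - 1) = apery_half n"
    by (simp_all add: apery_half_def v_def add_ac)
  moreover have "4 * (v + 1)\<^sup>2 = (2 * real n + 3)\<^sup>2" "4 * (11 * v\<^sup>2 + 11 * v + 3) = 44 * (real n + 1)\<^sup>2 + 1"
    "4 * v\<^sup>2 = (2 * real n + 1)\<^sup>2"
    by (simp_all add: v_def power2_eq_square field_simps)
  ultimately show ?thesis by (metis (no_types, lifting) distrib_left mult.assoc)
qed

definition cf_limit :: real where "cf_limit = (Gamma (1/4) / Gamma (3/4)) ^ 4"

lemma cf_limit_pos: "cf_limit > 0"
  unfolding cf_limit_def by (intro zero_less_power divide_pos_pos Gamma_real_pos) auto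

lemma apery_half_0_square: "apery_half 0 ^ 2 = pi\<^sup>2 * cf_limit / 4"
  using apery_F_minus_half_value by (simp add: apery_half_def cf_limit_def power_mult_distrib power_divide flip: power_mult)

lemma apery_half_1: "apery_half 1 = (40 / cf_limit - 1/2) * apery_half 0"
  using apery_F_half_value by (simp add: apery_half_def cf_limit_def)

primrec odd_fact_sq :: "nat \<Rightarrow> real" where
  "odd_fact_sq 0 = 1"
| "odd_fact_sq (Suc n) = (2 * real n + 1)\<^sup>2 * odd_fact_sq n"

lemma odd_fact_sq_pos: "odd_fact_sq n > 0"
  by (induction n) auto

lemma cf_remainder_eq: "cf_num n - cf_limit * cf_den n = (-1) ^ n * (2 * cf_limit / apery_half 0) * odd_fact_sq (Suc n) * apery_half (Suc n)"
proof -
  \<comment> \<open>Chosen so that c F(-1/2) = 2V, with F for \<open>apery_F\<close>; then c F(1/2)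
    = 80 - V is exactly the remainder at index 0.\<close>
  define c where "c = 2 * cf_limit / apery_half 0"
  define m where "m = (\<lambda>n. (-1) ^ n * c * odd_fact_sq (Suc n) * apery_half (Suc n))"
  have c: "c * apery_half 0 = 2 * cf_limit" using apery_half_pos[of 0] by (simp add: c_def)
  have cf1: "c * apery_half 1 = 80 - cf_limit"
  proof -
    have "c * apery_half 1 = (40 / cf_limit - 1/2) * (c * apery_half 0)" by (subst apery_half_1) simp
    also have "\<dots> = 80 - cf_limit" using cf_limit_pos unfolding c by (simp add: field_simps)
    finally show ?thesis .
  qed
  have "9 * apery_half 2 + 45 * apery_half 1 = apery_half 0" using apery_half_recurrence[of 0] by (simp add: eval_nat_numeral)
  hence "c * (9 * apery_half 2 + 45 * apery_half 1) = c * apery_half 0" by simp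
  hence "9 * (c * apery_half 2) + 45 * (c * apery_half 1) = c * apery_half 0" by (simp add: algebra_simps)
  \<comment> \<open>The recurrence supplies 45, and the 2V from c \<open>apery_half 0\<close> raises
    45 V to 47 V: this accounts for the exceptional entry a(1) = 47.\<close>
  hence cf2: "9 * (c * apery_half 2) = 47 * cf_limit - 3600" unfolding c cf1 by simp
  have "cf_num n - cf_limit * cf_den n = m n \<and> cf_num (n + 1) - cf_limit * cf_den (n + 1) = m (n + 1)"
  proof (induction n)
    case 0
    have "m 0 = 80 - cf_limit" using cf1 by (simp add: m_def)
    moreover have "m 1 = 3600 - 47 * cf_limit" using cf2 by (simp add: m_def eval_nat_numeral)
    ultimately show ?case using cf_num_den_init by simp
  next
    case (Suc n)
    have "cf_num (n + 2) - cf_limit * cf_den (n + 2) = cfA (n + 2) * (cf_num (n + 1) - cf_limit * cf_den (n + 1)) + cfB (n + 1) * (cf_num n - cf_limit * cf_den n)"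
      unfolding cf_num_recurrence cf_den_recurrence by (simp add: algebra_simps)
    also have "\<dots> = cfA (n + 2) * m (n + 1) + cfB (n + 1) * m n" using Suc.IH by simp
    also have "\<dots> = m (n + 2)"
    proof -
      define x where "x = real n"
      define e where "e = (-1) ^ n * c * odd_fact_sq (Suc n) * (2 * x + 3)\<^sup>2"
      have "m (n + 2) = e * ((2 * x + 5)\<^sup>2 * apery_half (n + 3))"
        by (simp add: m_def e_def x_def eval_nat_numeral mult_ac add_ac)
      also have "(2 * x + 5)\<^sup>2 * apery_half (n + 3) = (2 * x + 3)\<^sup>2 * apery_half (n + 1) - (44 * (x + 2)\<^sup>2 + 1) * apery_half (n + 2)"
        using apery_half_recurrence[of "n + 1"] by (simp add: x_def eval_nat_numeral add_ac algebra_simps)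
      finally have "m (n + 2) = e * ((2 * x + 3)\<^sup>2 * apery_half (n + 1) - (44 * (x + 2)\<^sup>2 + 1) * apery_half (n + 2))" .
      moreover have "m (n + 1) = - e * apery_half (n + 2)"
        by (simp add: m_def e_def x_def mult_ac add_ac)
      moreover have "cfB (n + 1) * m n = e * (2 * x + 3)\<^sup>2 * apery_half (n + 1)"
        by (simp add: m_def e_def x_def cfB_def power4_eq_xxxx power2_eq_square mult_ac add_ac)
      moreover have "cfA (n + 2) = 44 * (x + 2)\<^sup>2 + 1" by (simp add: cfA_def x_def add_ac)
      ultimately show ?thesis by (simp add: algebra_simps)
    qed
    finally show ?case using Suc.IH by simp
  qed
  thus ?thesis by (simp add: m_def c_def)
qed

text \<open>The multiples of \<open>cf_limit\<close> cancel, leaving the usual determinant of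
  consecutive convergents. It starts at 80 * 47 - 3600 = 160 and is multiplied by -b(n + 1) = -(2n +
  3)^4 at each step.\<close>

lemma cf_casoratian: "cf_den (n + 1) * (cf_num n - cf_limit * cf_den n) - cf_den n * (cf_num (n + 1) - cf_limit * cf_den (n + 1)) = (-1) ^ n * 160 * odd_fact_sq (Suc n) ^ 2"
proof (induction n)
  case 0
  show ?case using cf_num_den_init by (simp add: algebra_simps)
next
  case (Suc n)
  have "cf_den (n + 2) * (cf_num (n + 1) - cf_limit * cf_den (n + 1)) - cf_den (n + 1) * (cf_num (n + 2) - cf_limit * cf_den (n + 2))
     = - cfB (n + 1) * (cf_den (n + 1) * (cf_num n - cf_limit * cf_den n) - cf_den n * (cf_num (n + 1) - cf_limit * cf_den (n + 1)))"
    unfolding cf_num_recurrence cf_den_recurrence by (simp add: algebra_simps)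
  also have "\<dots> = (-1) ^ Suc n * 160 * ((2 * real n + 3) ^ 4 * odd_fact_sq (Suc n) ^ 2)"
    unfolding Suc.IH by (simp add: cfB_def add_ac)
  also have "(2 * real n + 3) ^ 4 * odd_fact_sq (Suc n) ^ 2 = odd_fact_sq (Suc (Suc n)) ^ 2"
    by (simp add: power_mult_distrib flip: power_mult) (simp add: add_ac)
  finally show ?case by (simp add: add_ac)
qed

text \<open>The Casoratian with the remainders replaced by integrals. Both summands are positive, so
  the size of the denominators can be read off without cancellation.\<close>

lemma cf_den_apery_half: "cf_den (n + 1) * apery_half (n + 1) + (2 * real n + 3)\<^sup>2 * cf_den n * apery_half (n + 2) = 80 * apery_half 0 * odd_fact_sq (Suc n) / cf_limit"
proof -
  define e where "e = (-1) ^ n * (2 * cf_limit / apery_half 0) * odd_fact_sq (Suc n)"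
  have e0: "e \<noteq> 0" using cf_limit_pos apery_half_pos[of 0] odd_fact_sq_pos[of n] by (simp add: e_def)
  have 1: "cf_num n - cf_limit * cf_den n = e * apery_half (n + 1)" by (simp add: cf_remainder_eq e_def)
  have 2: "cf_num (n + 1) - cf_limit * cf_den (n + 1) = - e * (2 * real n + 3)\<^sup>2 * apery_half (n + 2)"
    by (simp add: cf_remainder_eq e_def mult_ac add_ac)
  have "e * (cf_den (n + 1) * apery_half (n + 1) + (2 * real n + 3)\<^sup>2 * cf_den n * apery_half (n + 2)) = (-1) ^ n * 160 * odd_fact_sq (Suc n) ^ 2"
    unfolding cf_casoratian[symmetric] 1 2 by (simp add: algebra_simps)
  also have "\<dots> = e * (80 * apery_half 0 * odd_fact_sq (Suc n) / cf_limit)"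
    using cf_limit_pos apery_half_pos[of 0] by (simp add: e_def power2_eq_square)
  finally show ?thesis using mult_left_cancel[OF e0] by blast
qed

section \<open>Ratio of consecutive denominators and exact size of the error\<close>

lemma half_contraction_tendsto_0:
  fixes x e :: "nat \<Rightarrow> real"
  assumes nonneg: "\<And>n. x n \<ge> 0" and step: "\<And>n. x (Suc n) \<le> e n + x n / 2" and e: "e \<longlonglongrightarrow> 0"
  shows "x \<longlonglongrightarrow> 0"
proof (rule tendstoI)
  fix r :: real assume r: "r > 0"
  have "\<forall>\<^sub>F n in sequentially. e n < r / 4" using order_tendstoD(2)[OF e, of "r / 4"] r by simp
  then obtain N where N: "\<And>n. n \<ge> N \<Longrightarrow> e n < r / 4" by (auto simp: eventually_sequentially)
  \<comment> \<open>Once e < r/4, the step is dominated by t \<mapsto> r/4 + t/2, whose fixed point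
    is r/2.\<close>
  have bound: "x (N + k) \<le> r / 2 + x N / 2 ^ k" for k
  proof (induction k)
    case (Suc k)
    have "x (N + Suc k) \<le> r / 4 + x (N + k) / 2" using step[of "N + k"] N[of "N + k"] by simp
    also have "\<dots> \<le> r / 4 + (r / 2 + x N / 2 ^ k) / 2" using Suc.IH by simp
    also have "\<dots> = r / 2 + x N / 2 ^ Suc k" by (simp add: field_simps)
    finally show ?case .
  qed (use r in simp)
  have "(\<lambda>k. r / 2 + x N / 2 ^ k) \<longlonglongrightarrow> r / 2" by real_asymp
  from order_tendstoD(2)[OF this, of r] have "\<forall>\<^sub>F k in sequentially. r / 2 + x N / 2 ^ k < r"
    using r by simp
  hence "\<forall>\<^sub>F k in sequentially. x (k + N) < r"
    by eventually_elim (use bound in \<open>metis add.commute le_less_trans\<close>)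
  hence "\<forall>\<^sub>F k in sequentially. x k < r" by (rule eventually_sequentially_seg[of "\<lambda>k. x k < r" N, THEN iffD1])
  thus "\<forall>\<^sub>F n in sequentially. dist (x n) 0 < r" by eventually_elim (use nonneg in simp)
qed

lemma phi_5: "phi ^ 5 = (11 + 5 * sqrt 5) / 2" "1 / phi ^ 5 = (5 * sqrt 5 - 11) / 2"
proof -
  have "phi ^ 5 = 5 * phi + 3" using phi_square by algebra
  also have "\<dots> = (11 + 5 * sqrt 5) / 2" by (simp add: phi_def)
  finally show 1: "phi ^ 5 = (11 + 5 * sqrt 5) / 2" .
  have "(11 + 5 * sqrt 5) / 2 * ((5 * sqrt 5 - 11) / 2) = 1" by (simp add: field_simps)
  hence "phi ^ 5 * ((5 * sqrt 5 - 11) / 2) = 1" unfolding 1 .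
  thus "1 / phi ^ 5 = (5 * sqrt 5 - 11) / 2" using phi_gt_1 by (simp add: field_simps)
qed

text \<open>Quotient of consecutive denominators after division of \<open>cf_den n\<close> by
  \<open>odd_fact_sq (Suc n)\<close>; the factor (2n + 3)^2 is the quotient of these
  normalisations.\<close>

definition den_ratio :: "nat \<Rightarrow> real" where "den_ratio n = (2 * real n + 3)\<^sup>2 * cf_den n / cf_den (n + 1)"

text \<open>The three-term recurrence becomes the Riccati iteration r \<mapsto> 1 / (A + B r) with A
  tending to 11 and B to 1. The limit is the positive root of l (11 + l) = 1, namely 1 /
  phi^5.\<close>

lemma den_ratio_tendsto: "den_ratio \<longlonglongrightarrow> 1 / phi ^ 5"
proof -
  define l where "l = 1 / phi ^ 5"
  define A where "A = (\<lambda>n. (44 * (real n + 2)\<^sup>2 + 1) / (2 * real n + 5)\<^sup>2)"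
  define B where "B = (\<lambda>n. (2 * real n + 3)\<^sup>2 / (2 * real n + 5)\<^sup>2)"
  have l: "0 < l" "l < 1" using phi_gt_1 by (auto simp: l_def)
  have l_fix: "l * (11 + l) = 1" unfolding l_def phi_5(2) by (simp add: field_simps)
  have A5: "A n \<ge> 5" for n
  proof -
    have "5 * (2 * real n + 5)\<^sup>2 \<le> 44 * (real n + 2)\<^sup>2 + 1" by (simp add: power2_eq_square algebra_simps)
    thus ?thesis by (simp add: A_def le_divide_eq)
  qed
  have B: "0 \<le> B n" "B n \<le> 1" for n by (auto simp: B_def divide_le_eq intro!: power_mono)
  have rpos: "den_ratio n > 0" for n using cf_den_pos[of n] cf_den_pos[of "n + 1"] by (simp add: den_ratio_def)
  have r_Suc: "den_ratio (Suc n) = 1 / (A n + B n * den_ratio n)" for n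
  proof -
    define q where "q = 2 * real n + 5"
    define t where "t = 2 * real n + 3"
    have q: "q > 0" by (simp add: q_def)
    have "A n + B n * den_ratio n = (44 * (real n + 2)\<^sup>2 + 1 + t\<^sup>2 * den_ratio n) / q\<^sup>2"
      by (simp add: A_def B_def q_def t_def add_divide_distrib)
    also have "44 * (real n + 2)\<^sup>2 + 1 + t\<^sup>2 * den_ratio n = cf_den (n + 2) / cf_den (n + 1)"
    proof -
      have "cf_den (n + 2) = (44 * (real n + 2)\<^sup>2 + 1) * cf_den (n + 1) + t\<^sup>2 * t\<^sup>2 * cf_den n"
        unfolding cf_den_recurrence by (simp add: cfA_def cfB_def t_def add_ac flip: power_add)
      thus ?thesis using cf_den_pos[of "n + 1"] by (simp add: den_ratio_def t_def add_divide_distrib)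
    qed
    finally show ?thesis by (simp add: den_ratio_def q_def)
  qed
  have r1: "den_ratio (Suc n) \<le> 1" for n
  proof -
    have "A n + B n * den_ratio n \<ge> 1" using A5[of n] B[of n] rpos[of n] by (simp add: add_increasing2)
    thus ?thesis by (simp add: r_Suc)
  qed
  \<comment> \<open>Since l < 1 and the denominator is at least 5, one step contracts the distance
    to l by more than 1/2, up to the errors of A and B. The index starts at 1 because the bound
    \<open>r1\<close> is obtained from a previous step.\<close>
  have "(\<lambda>n. \<bar>den_ratio (Suc n) - l\<bar>) \<longlonglongrightarrow> 0"
  proof (rule half_contraction_tendsto_0)
    show "(\<lambda>n. \<bar>11 - A (Suc n)\<bar> + \<bar>1 - B (Suc n)\<bar>) \<longlonglongrightarrow> 0"
      unfolding A_def B_def by real_asymp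
    fix n
    define D where "D = A (Suc n) + B (Suc n) * den_ratio (Suc n)"
    have D: "D \<ge> 5" using A5[of "Suc n"] B[of "Suc n"] rpos[of "Suc n"] by (simp add: D_def add_increasing2)
    have "den_ratio (Suc (Suc n)) - l = (1 - l * D) / D" using D by (simp add: r_Suc[of "Suc n"] D_def[symmetric] field_simps)
    also have "1 - l * D = l * ((11 - A (Suc n)) + (1 - B (Suc n)) * den_ratio (Suc n) + (l - den_ratio (Suc n)))"
      using l_fix by (simp add: D_def algebra_simps)
    finally have "\<bar>den_ratio (Suc (Suc n)) - l\<bar> = l / D * \<bar>(11 - A (Suc n)) + (1 - B (Suc n)) * den_ratio (Suc n) + (l - den_ratio (Suc n))\<bar>"
      using l D by (simp add: abs_mult)
    also have "\<dots> \<le> 1/2 * (\<bar>11 - A (Suc n)\<bar> + \<bar>1 - B (Suc n)\<bar> + \<bar>den_ratio (Suc n) - l\<bar>)"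
    proof (rule mult_mono)
      show "l / D \<le> 1/2" using l D by (simp add: field_simps)
      have "\<bar>(1 - B (Suc n)) * den_ratio (Suc n)\<bar> \<le> \<bar>1 - B (Suc n)\<bar> * 1"
        unfolding abs_mult using r1[of n] rpos[of "Suc n"] by (intro mult_left_mono) auto
      moreover have "\<bar>u + v + (l - w)\<bar> \<le> \<bar>u\<bar> + s + \<bar>w - l\<bar>" if "\<bar>v\<bar> \<le> s * 1" for u v w s :: real
        using that by linarith
      ultimately show "\<bar>(11 - A (Suc n)) + (1 - B (Suc n)) * den_ratio (Suc n) + (l - den_ratio (Suc n))\<bar> \<le>
         \<bar>11 - A (Suc n)\<bar> + \<bar>1 - B (Suc n)\<bar> + \<bar>den_ratio (Suc n) - l\<bar>" by blast
    qed auto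
    also have "\<dots> \<le> (\<bar>11 - A (Suc n)\<bar> + \<bar>1 - B (Suc n)\<bar>) + \<bar>den_ratio (Suc n) - l\<bar> / 2" by simp
    finally show "\<bar>den_ratio (Suc (Suc n)) - l\<bar> \<le> (\<bar>11 - A (Suc n)\<bar> + \<bar>1 - B (Suc n)\<bar>) + \<bar>den_ratio (Suc n) - l\<bar> / 2" .
  qed auto
  hence "(\<lambda>n. den_ratio (Suc n) - l) \<longlonglongrightarrow> 0" by (simp add: tendsto_rabs_zero_iff)
  hence "(\<lambda>n. den_ratio (Suc n)) \<longlonglongrightarrow> l" by (simp add: LIM_zero_iff)
  thus ?thesis unfolding l_def by (rule LIMSEQ_imp_Suc)
qed

text \<open>The error is minus the remainder over the denominator; \<open>cf_den_apery_half\<close>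
  removes the latter, leaving a product of two integrals. The index is n + 1 because
  \<open>den_ratio n\<close> compares n with n + 1.\<close>

lemma error_eq:
  "cf_limit - cf_num (n + 1) / cf_den (n + 1) =
    (-1) ^ n * (cf_limit\<^sup>2 / (40 * apery_half 0 ^ 2)) * ((2 * real n + 3)\<^sup>2 * apery_half (n + 2) * (apery_half (n + 1) + apery_half (n + 2) * den_ratio n))"
proof -
  have Q0: "cf_den (n + 1) > 0" by (rule cf_den_pos)
  have f0: "apery_half 0 > 0" by (rule apery_half_pos)
  have d0: "odd_fact_sq (Suc n) > 0" by (rule odd_fact_sq_pos)
  have "cf_limit - cf_num (n + 1) / cf_den (n + 1) = - (cf_num (n + 1) - cf_limit * cf_den (n + 1)) / cf_den (n + 1)"
    using Q0 by (simp add: field_simps)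
  also have "\<dots> = (-1) ^ n * (2 * cf_limit / apery_half 0) * ((2 * real n + 3)\<^sup>2 * apery_half (n + 2)) * (odd_fact_sq (Suc n) / cf_den (n + 1))"
    unfolding cf_remainder_eq by (simp add: mult_ac add_ac)
  also have "odd_fact_sq (Suc n) / cf_den (n + 1) = cf_limit / (80 * apery_half 0) * (apery_half (n + 1) + apery_half (n + 2) * den_ratio n)"
  proof -
    have "odd_fact_sq (Suc n) = cf_limit / (80 * apery_half 0) * (cf_den (n + 1) * apery_half (n + 1) + (2 * real n + 3)\<^sup>2 * cf_den n * apery_half (n + 2))"
      unfolding cf_den_apery_half using cf_limit_pos f0 by simp
    also have "cf_den (n + 1) * apery_half (n + 1) + (2 * real n + 3)\<^sup>2 * cf_den n * apery_half (n + 2) = cf_den (n + 1) * (apery_half (n + 1) + apery_half (n + 2) * den_ratio n)"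
      using Q0 by (simp add: den_ratio_def distrib_left)
    finally show ?thesis using Q0 by simp
  qed
  finally show ?thesis by (simp add: power2_eq_square mult_ac)
qed

lemma error_scaled_tendsto:
  "(\<lambda>n. cf_limit\<^sup>2 / (40 * apery_half 0 ^ 2) * ((2 * real n + 3)\<^sup>2 * apery_half (n + 2) * (apery_half (n + 1) + apery_half (n + 2) * den_ratio n)) * (phi ^ 5) ^ (2 * n + 4))
     \<longlonglongrightarrow> 8 * cf_limit"
proof -
  define q where "q = phi ^ 5"
  define C where "C = 2 * pi / sqrt (sqrt 5)"
  define h where "h = (\<lambda>n. real n * q ^ n * apery_half n)"
  have q: "q > 0" using phi_gt_1 by (simp add: q_def)
  have hl: "h \<longlonglongrightarrow> C"
    using apery_F_half_integer_asymp by (simp add: h_def C_def apery_half_def q_def power_mult)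
  have h1: "(\<lambda>n. h (n + 1)) \<longlonglongrightarrow> C" and h2: "(\<lambda>n. h (n + 2)) \<longlonglongrightarrow> C"
    by (intro LIMSEQ_ignore_initial_segment hl)+
  have 1: "(\<lambda>n. (2 * real n + 3)\<^sup>2 / ((real n + 1) * (real n + 2))) \<longlonglongrightarrow> 4" by real_asymp
  have 2: "(\<lambda>n. (2 * real n + 3)\<^sup>2 / (real n + 2)\<^sup>2) \<longlonglongrightarrow> 4" by real_asymp
  have "(\<lambda>n. cf_limit\<^sup>2 / (40 * apery_half 0 ^ 2) *
       ((2 * real n + 3)\<^sup>2 / ((real n + 1) * (real n + 2)) * (q * (h (n + 2) * h (n + 1)))
        + (2 * real n + 3)\<^sup>2 / (real n + 2)\<^sup>2 * (h (n + 2) * h (n + 2) * den_ratio n)))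
     \<longlonglongrightarrow> cf_limit\<^sup>2 / (40 * apery_half 0 ^ 2) * (4 * (q * (C * C)) + 4 * (C * C * (1 / q)))"
    using den_ratio_tendsto unfolding q_def[symmetric]
    by (intro tendsto_mult tendsto_add tendsto_const 1 2 h1 h2)
  \<comment> \<open>Here sqrt 5 cancels: C^2 = 4 pi^2 / sqrt 5 and q + 1/q = 5 sqrt 5 give 80 pi^2,
    and the square of \<open>apery_half 0\<close>, equal to pi^2 V / 4, removes pi.\<close>
  also have "cf_limit\<^sup>2 / (40 * apery_half 0 ^ 2) * (4 * (q * (C * C)) + 4 * (C * C * (1 / q))) = 8 * cf_limit"
  proof -
    have "C * C = 4 * pi\<^sup>2 / sqrt 5" by (simp add: C_def power2_eq_square)
    moreover have "q + 1 / q = (11 + 5 * sqrt 5) / 2 + (5 * sqrt 5 - 11) / 2"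
      unfolding q_def by (intro arg_cong2[where f = "(+)"] phi_5)
    hence "q + 1 / q = 5 * sqrt 5" by (simp add: field_simps)
    moreover have "4 * (q * (C * C)) + 4 * (C * C * (1 / q)) = 4 * (C * C) * (q + 1 / q)" by (simp add: algebra_simps)
    ultimately have eq: "4 * (q * (C * C)) + 4 * (C * C * (1 / q)) = 80 * pi\<^sup>2" by simp
    show ?thesis unfolding eq apery_half_0_square using cf_limit_pos by (simp add: power2_eq_square)
  qed
  also have "(\<lambda>n. cf_limit\<^sup>2 / (40 * apery_half 0 ^ 2) *
       ((2 * real n + 3)\<^sup>2 / ((real n + 1) * (real n + 2)) * (q * (h (n + 2) * h (n + 1)))
        + (2 * real n + 3)\<^sup>2 / (real n + 2)\<^sup>2 * (h (n + 2) * h (n + 2) * den_ratio n)))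
     = (\<lambda>n. cf_limit\<^sup>2 / (40 * apery_half 0 ^ 2) * ((2 * real n + 3)\<^sup>2 * apery_half (n + 2) * (apery_half (n + 1) + apery_half (n + 2) * den_ratio n)) * q ^ (2 * n + 4))"
  proof
    fix n
    define Y where "Y = q ^ n"
    define x where "x = real n"
    have x: "x \<ge> 0" by (simp add: x_def)
    have h: "h (n + 1) = (x + 1) * (q * Y) * apery_half (n + 1)" "h (n + 2) = (x + 2) * (q\<^sup>2 * Y) * apery_half (n + 2)"
      by (simp_all add: h_def x_def Y_def power_add power2_eq_square)
    have Y: "q ^ (2 * n + 4) = q\<^sup>2 * q\<^sup>2 * Y * Y"
      by (simp add: Y_def power_add mult_2 eval_nat_numeral)
    have a: "(2 * x + 3)\<^sup>2 / ((x + 1) * (x + 2)) * (q * (h (n + 2) * h (n + 1))) = (2 * x + 3)\<^sup>2 * apery_half (n + 2) * apery_half (n + 1) * (q\<^sup>2 * q\<^sup>2 * Y * Y)"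
      unfolding h using x by (simp add: divide_simps) (simp add: power2_eq_square power4_eq_xxxx)
    have b: "(2 * x + 3)\<^sup>2 / (x + 2)\<^sup>2 * (h (n + 2) * h (n + 2) * den_ratio n) = (2 * x + 3)\<^sup>2 * apery_half (n + 2) * (apery_half (n + 2) * den_ratio n) * (q\<^sup>2 * q\<^sup>2 * Y * Y)"
      unfolding h using x by (simp add: divide_simps) (simp add: power2_eq_square power4_eq_xxxx)
    show "cf_limit\<^sup>2 / (40 * apery_half 0 ^ 2) *
       ((2 * real n + 3)\<^sup>2 / ((real n + 1) * (real n + 2)) * (q * (h (n + 2) * h (n + 1)))
        + (2 * real n + 3)\<^sup>2 / (real n + 2)\<^sup>2 * (h (n + 2) * h (n + 2) * den_ratio n))
     = cf_limit\<^sup>2 / (40 * apery_half 0 ^ 2) * ((2 * real n + 3)\<^sup>2 * apery_half (n + 2) * (apery_half (n + 1) + apery_half (n + 2) * den_ratio n)) * q ^ (2 * n + 4)"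
      unfolding Y x_def[symmetric] a b by (simp only: distrib_left distrib_right mult.assoc)
  qed
  finally show ?thesis by (simp only: q_def)
qed

theorem theorem2p1:
  shows "(\<lambda>n. cf_convergent cfA cfB n) \<longlonglongrightarrow> (Gamma (1/4) / Gamma (3/4)) ^ 4
    \<and> (\<lambda>n. (Gamma (1/4) / Gamma (3/4)) ^ 4 - cf_convergent cfA cfB n) \<sim>[sequentially]
      (\<lambda>n. (-1) ^ (n + 1) * 8 * (Gamma (1/4) / Gamma (3/4)) ^ 4
              / ((1 + sqrt 5) / 2) ^ (10 * n + 10))"
proof -
  define e where "e = (\<lambda>n. cf_limit - cf_convergent cfA cfB n)"
  define b where "b = (\<lambda>n. (-1) ^ (n + 1) * 8 * cf_limit / phi ^ (10 * n + 10))"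
  have b0: "b n \<noteq> 0" for n using cf_limit_pos phi_gt_1 by (simp add: b_def)
  have "(\<lambda>n. cf_limit\<^sup>2 / (40 * apery_half 0 ^ 2) * ((2 * real n + 3)\<^sup>2 * apery_half (n + 2) * (apery_half (n + 1) + apery_half (n + 2) * den_ratio n)) * (phi ^ 5) ^ (2 * n + 4) / (8 * cf_limit))
     \<longlonglongrightarrow> 8 * cf_limit / (8 * cf_limit)"
    using cf_limit_pos by (intro tendsto_divide error_scaled_tendsto) auto
  moreover have "cf_limit\<^sup>2 / (40 * apery_half 0 ^ 2) * ((2 * real n + 3)\<^sup>2 * apery_half (n + 2) * (apery_half (n + 1) + apery_half (n + 2) * den_ratio n)) * (phi ^ 5) ^ (2 * n + 4) / (8 * cf_limit)
     = e (Suc n) / b (Suc n)" for n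
  proof -
    define E where "E = cf_limit\<^sup>2 / (40 * apery_half 0 ^ 2) * ((2 * real n + 3)\<^sup>2 * apery_half (n + 2) * (apery_half (n + 1) + apery_half (n + 2) * den_ratio n))"
    have "e (Suc n) = (-1) ^ n * E"
      using error_eq[of n] by (simp add: e_def cf_convergent_eq E_def)
    moreover have "b (Suc n) = (-1) ^ n * (8 * cf_limit / (phi ^ 5) ^ (2 * n + 4))"
      by (simp add: b_def algebra_simps flip: power_mult)
    moreover have "((-1) ^ n * E) / ((-1) ^ n * (8 * cf_limit / (phi ^ 5) ^ (2 * n + 4))) = E * (phi ^ 5) ^ (2 * n + 4) / (8 * cf_limit)"
      by simp
    ultimately show ?thesis by (simp only: E_def)
  qed
  ultimately have "(\<lambda>n. e (Suc n) / b (Suc n)) \<longlonglongrightarrow> 1" using cf_limit_pos by simp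
  hence ratio: "(\<lambda>n. e n / b n) \<longlonglongrightarrow> 1" by (rule LIMSEQ_imp_Suc)
  hence asymp: "e \<sim>[sequentially] b" by (rule asymp_equivI')
  \<comment> \<open>Convergence is deduced from the asymptotics: the error is \<open>b\<close> times
    a ratio tending to 1, and \<open>b\<close> decays geometrically.\<close>
  have "(\<lambda>n. norm (b n)) \<longlonglongrightarrow> 0"
  proof -
    have "(\<lambda>n. 8 * cf_limit / phi ^ 10 * (1 / phi ^ 10) ^ n) \<longlonglongrightarrow> 8 * cf_limit / phi ^ 10 * 0"
      using phi_gt_1 by (intro tendsto_mult tendsto_const LIMSEQ_realpow_zero) auto
    moreover have "norm (b n) = 8 * cf_limit / phi ^ 10 * (1 / phi ^ 10) ^ n" for n
      using cf_limit_pos phi_gt_1 by (simp add: b_def abs_mult power_add power_mult power_divide)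
    ultimately show ?thesis by simp
  qed
  hence "b \<longlonglongrightarrow> 0" by (rule tendsto_norm_zero_cancel)
  from tendsto_mult[OF ratio this] have "e \<longlonglongrightarrow> 0" using b0 by simp
  hence "(\<lambda>n. cf_limit - e n) \<longlonglongrightarrow> cf_limit - 0" by (intro tendsto_intros)
  hence "(\<lambda>n. cf_convergent cfA cfB n) \<longlonglongrightarrow> cf_limit" by (simp add: e_def)
  with asymp show ?thesis unfolding e_def b_def cf_limit_def phi_def by blast
qed

end
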